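(* Let $\psi:\mathcal X\times\mathcal Y\to\mathbb R$ be a continuous convex-concave function with a $\mathcal K$-representation $$\psi(x,[w;z])=\inf_{[g;h],\tau,u}\{g^Tw+h^Tz+\tau: Gg+Hh+\tau p+Qu+Rx\leq_{\mathbf K}s\}\quad\forall x\in\mathcal X,\ y=[w;z]\in\mathcal Y\qquad[\mathbf K\in\mathcal K].$$ Let $\mathcal Y$ be compact and given by a $\mathcal K$-representation $$\mathcal Y=\{[w;z]:\exists v: Aw+Bz+Cv\leq_{\mathbf L}r\}\qquad[\mathbf L\in\mathcal K]$$ such that the conic constraint $Bz+Cv\leq_{\mathbf L}r-Aw$ in variables $z,v$ is essentially strictly feasible for every $w\in\mathcal W=\{w:\exists z:[w;z]\in\mathcal Y\}$. Then the function $$\overline\psi(x,w):=\max_z\{\psi(x,[w;z]):[w;z]\in\mathcal Y\}:\mathcal X\times\mathcal W\to\mathbb R$$ is, provided it is continuous, $\mathcal K$-representable on $\mathcal X\times\mathcal W$, with the $\mathcal K$-representation $$\overline\psi(x,w)=\inf_{f,t,g,h,\tau,u,\xi}\left\{f^Tw+t:\ \begin{array}{l} f=g-A^T\xi,\ t=r^T\xi+\tau,\ B^T\xi=h,\ C^T\xi=0,\\ \xi\geq_{\mathbf L^*}0,\ Gg+Hh+\tau p+Qu+Rx\leq_{\mathbf K}s\end{array}\right\}\quad\forall x\in\mathcal X,\ w\in\mathcal W.$$ Moreover, this last identity holds also without the assumption that $\overline\psi$ is continuous.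
   Context: $\mathcal K$ is a fixed family of regular cones (closed, convex, pointed, with nonempty interior) in Euclidean spaces which contains $\mathbb R_+$, is closed under finite direct products, and is closed under passing from a cone $\mathbf K$ to its dual $\mathbf K^*$. $a\leq_{\mathbf K}b$ means $b-a\in\mathbf K$. $[w;z]$ denotes vertical concatenation. $\mathcal X,\mathcal Y$ are nonempty convex $\mathcal K$-representable sets, where a set is $\mathcal K$-representable if it is of the form $\{x:\exists u:Ax+Bu\leq_{\mathbf K}c\}$ with $\mathbf K\in\mathcal K$. Finite systems of $\mathcal K$-conic constraints, linear equalities and nonstrict linear inequalities are (equivalent to) a single $\mathcal K$-conic constraint. A conic constraint $Ax\leq_{\mathbf K}a$ is essentially strictly feasible if $\mathbf K=\mathbb R^m_+\times\mathbf M$ with regular $\mathbf M$ (either factor may be absent), so that it reads $Px\leq p$, $Qx\leq_{\mathbf M}q$, and there is $\bar x$ with $P\bar x\leq p$ and $q-Q\bar x\in\operatorname{int}\mathbf M$. A continuous convex-concave (convex in $x$, concave in $y$) function $\psi:\mathcal X\times\mathcal Y\to\mathbb R$ is $\mathcal K$-representable on $\mathcal X\times\mathcal Y$ if $\psi(x,y)=\inf_{f,t,u}\{f^Ty+t:Pf+tp+Qu+Rx\leq_{\mathbf K}s\}$ for all $x\in\mathcal X,y\in\mathcal Y$, with some $\mathbf K\in\mathcal K$ (the constraint may be given as an equivalent finite system). *)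

theory Defs
  imports "HOL-Analysis.Analysis" "Jordan_Normal_Form.Matrix"
begin

unbundle no inner_syntax
unbundle no vec_syntax

notation scalar_prod (infix \<open>\<bullet>\<close> 70)
notation vec_index (infixl \<open>$\<close> 100)

text \<open>
  Dimensions have to be quantified over, so points of \<open>\<real>\<^sup>n\<close> are elements of
  \<^term>\<open>carrier_vec n\<close>.  Dimension \<open>0\<close> is allowed everywhere; it encodes an absent block.
\<close>

text \<open>The Euclidean topology, transported from the product topology on coordinates.\<close>

definition vec_topology :: "nat \<Rightarrow> real Matrix.vec topology" where
  "vec_topology n =
     pullback_topology (carrier_vec n) (\<lambda>x. \<lambda>i\<in>{..<n}. x $ i) (powertop_real {..<n})"

definition vec_convex :: "real Matrix.vec set \<Rightarrow> bool" where
  "vec_convex S \<longleftrightarrow>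
     (\<forall>x\<in>S. \<forall>y\<in>S. \<forall>a\<ge>0. \<forall>b\<ge>0. a + b = 1 \<longrightarrow> a \<cdot>\<^sub>v x + b \<cdot>\<^sub>v y \<in> S)"

definition vec_convex_on :: "real Matrix.vec set \<Rightarrow> (real Matrix.vec \<Rightarrow> real) \<Rightarrow> bool" where
  "vec_convex_on S f \<longleftrightarrow>
     (\<forall>x\<in>S. \<forall>y\<in>S. \<forall>a\<ge>0. \<forall>b\<ge>0. a + b = 1 \<longrightarrow>
        f (a \<cdot>\<^sub>v x + b \<cdot>\<^sub>v y) \<le> a * f x + b * f y)"

definition append_cols :: "real mat \<Rightarrow> real mat \<Rightarrow> real mat" where
  "append_cols A B = transpose_mat (transpose_mat A @\<^sub>r transpose_mat B)"


subsection \<open>Cones\<close>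

definition regular_cone :: "nat \<Rightarrow> real Matrix.vec set \<Rightarrow> bool" where
  "regular_cone m K \<longleftrightarrow>
     K \<subseteq> carrier_vec m \<and>
     (\<forall>x\<in>K. \<forall>c\<ge>0. c \<cdot>\<^sub>v x \<in> K) \<and>
     closedin (vec_topology m) K \<and>
     vec_convex K \<and>
     (\<forall>x\<in>K. - x \<in> K \<longrightarrow> x = 0\<^sub>v m) \<and>
     vec_topology m interior_of K \<noteq> {}"

definition nonneg_orthant :: "nat \<Rightarrow> real Matrix.vec set" where
  "nonneg_orthant k = {x \<in> carrier_vec k. \<forall>i<k. 0 \<le> x $ i}"

definition cone_prod :: "real Matrix.vec set \<Rightarrow> real Matrix.vec set \<Rightarrow> real Matrix.vec set" where
  "cone_prod K M = {x @\<^sub>v y | x y. x \<in> K \<and> y \<in> M}"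

definition dual_cone :: "nat \<Rightarrow> real Matrix.vec set \<Rightarrow> real Matrix.vec set" where
  "dual_cone m K = {y \<in> carrier_vec m. \<forall>x\<in>K. 0 \<le> y \<bullet> x}"

definition conic_le :: "real Matrix.vec set \<Rightarrow> real Matrix.vec \<Rightarrow> real Matrix.vec \<Rightarrow> bool" where
  "conic_le K a b \<longleftrightarrow> b - a \<in> K"

text \<open>\<open>\<K> m\<close> consists of the members of the family that live in \<open>\<real>\<^sup>m\<close>.\<close>

definition cone_family :: "(nat \<Rightarrow> real Matrix.vec set set) \<Rightarrow> bool" where
  "cone_family \<K> \<longleftrightarrow>
     (\<forall>m. \<forall>K\<in>\<K> m. regular_cone m K) \<and>
     nonneg_orthant 1 \<in> \<K> 1 \<and>
     (\<forall>m n. \<forall>K\<in>\<K> m. \<forall>M\<in>\<K> n. cone_prod K M \<in> \<K> (m + n)) \<and>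
     (\<forall>m. \<forall>K\<in>\<K> m. dual_cone m K \<in> \<K> m)"

text \<open>
  Essential strict feasibility of \<open>A x \<le>\<^sub>K a\<close> with \<open>K \<subseteq> \<real>\<^sup>m\<close> and \<open>x \<in> \<real>\<^sup>n\<close>.
  An absent factor of \<open>K\<close> corresponds to \<open>k = 0\<close> or \<open>l = 0\<close>.
\<close>

definition ess_strictly_feasible ::
    "nat \<Rightarrow> real Matrix.vec set \<Rightarrow> nat \<Rightarrow> real mat \<Rightarrow> real Matrix.vec \<Rightarrow> bool" where
  "ess_strictly_feasible m K n A a \<longleftrightarrow>
     (\<exists>k l M P Q p q.
        m = k + l \<and> regular_cone l M \<and> K = cone_prod (nonneg_orthant k) M \<and>
        P \<in> carrier_mat k n \<and> Q \<in> carrier_mat l n \<and> A = P @\<^sub>r Q \<and>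
        p \<in> carrier_vec k \<and> q \<in> carrier_vec l \<and> a = p @\<^sub>v q \<and>
        (\<exists>x\<in>carrier_vec n. P *\<^sub>v x \<le> p \<and> q - Q *\<^sub>v x \<in> vec_topology l interior_of M))"


subsection \<open>Representable sets and functions\<close>

definition conic_representable_set ::
    "(nat \<Rightarrow> real Matrix.vec set set) \<Rightarrow> nat \<Rightarrow> real Matrix.vec set \<Rightarrow> bool" where
  "conic_representable_set \<K> n S \<longleftrightarrow>
     (\<exists>m nu. \<exists>K\<in>\<K> m. \<exists>A\<in>carrier_mat m n. \<exists>B\<in>carrier_mat m nu. \<exists>c\<in>carrier_vec m.
        S = {x \<in> carrier_vec n. \<exists>u\<in>carrier_vec nu. conic_le K (A *\<^sub>v x + B *\<^sub>v u) c})"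

definition conic_domain ::
    "(nat \<Rightarrow> real Matrix.vec set set) \<Rightarrow> nat \<Rightarrow> real Matrix.vec set \<Rightarrow> bool" where
  "conic_domain \<K> n S \<longleftrightarrow> S \<noteq> {} \<and> vec_convex S \<and> conic_representable_set \<K> n S"

definition continuous_convex_concave ::
    "nat \<Rightarrow> real Matrix.vec set \<Rightarrow> nat \<Rightarrow> real Matrix.vec set \<Rightarrow>
     (real Matrix.vec \<Rightarrow> real Matrix.vec \<Rightarrow> real) \<Rightarrow> bool" where
  "continuous_convex_concave nx X ny Y \<psi> \<longleftrightarrow>
     continuous_map
       (prod_topology (subtopology (vec_topology nx) X) (subtopology (vec_topology ny) Y))
       euclideanreal (\<lambda>(x, y). \<psi> x y) \<and>
     (\<forall>y\<in>Y. vec_convex_on X (\<lambda>x. \<psi> x y)) \<and>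
     (\<forall>x\<in>X. vec_convex_on Y (\<lambda>y. - \<psi> x y))"

text \<open>
  A system \<open>\<Phi> f t u x\<close>, typically given as a finite list of constraints, that is equivalent
  (in the same variables) to a single conic constraint \<open>P f + t p + Q u + R x \<le>\<^sub>K s\<close>.
\<close>

definition conic_system ::
    "(nat \<Rightarrow> real Matrix.vec set set) \<Rightarrow> nat \<Rightarrow> nat \<Rightarrow> nat \<Rightarrow>
     (real Matrix.vec \<Rightarrow> real \<Rightarrow> real Matrix.vec \<Rightarrow> real Matrix.vec \<Rightarrow> bool) \<Rightarrow> bool" where
  "conic_system \<K> ny nu nx \<Phi> \<longleftrightarrow>
     (\<exists>m. \<exists>K\<in>\<K> m. \<exists>P\<in>carrier_mat m ny. \<exists>p\<in>carrier_vec m. \<exists>Q\<in>carrier_mat m nu.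
        \<exists>R\<in>carrier_mat m nx. \<exists>s\<in>carrier_vec m.
        \<forall>f\<in>carrier_vec ny. \<forall>t. \<forall>u\<in>carrier_vec nu. \<forall>x\<in>carrier_vec nx.
          \<Phi> f t u x \<longleftrightarrow> conic_le K (P *\<^sub>v f + t \<cdot>\<^sub>v p + Q *\<^sub>v u + R *\<^sub>v x) s)"

text \<open>
  The infimum is taken in the extended reals, so the equation also says that the constraints
  are feasible and the objective is bounded below.
\<close>

definition conic_representation ::
    "(nat \<Rightarrow> real Matrix.vec set set) \<Rightarrow> nat \<Rightarrow> real Matrix.vec set \<Rightarrow> nat \<Rightarrow> real Matrix.vec set \<Rightarrow>
     (real Matrix.vec \<Rightarrow> real Matrix.vec \<Rightarrow> real) \<Rightarrow> nat \<Rightarrow>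
     (real Matrix.vec \<Rightarrow> real \<Rightarrow> real Matrix.vec \<Rightarrow> real Matrix.vec \<Rightarrow> bool) \<Rightarrow> bool" where
  "conic_representation \<K> nx X ny Y \<psi> nu \<Phi> \<longleftrightarrow>
     conic_system \<K> ny nu nx \<Phi> \<and>
     (\<forall>x\<in>X. \<forall>y\<in>Y. ereal (\<psi> x y) =
        Inf {ereal (f \<bullet> y + t) | f t u.
               f \<in> carrier_vec ny \<and> u \<in> carrier_vec nu \<and> \<Phi> f t u x})"

definition conic_representable_fun ::
    "(nat \<Rightarrow> real Matrix.vec set set) \<Rightarrow> nat \<Rightarrow> real Matrix.vec set \<Rightarrow> nat \<Rightarrow> real Matrix.vec set \<Rightarrow>
     (real Matrix.vec \<Rightarrow> real Matrix.vec \<Rightarrow> real) \<Rightarrow> bool" where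
  "conic_representable_fun \<K> nx X ny Y \<psi> \<longleftrightarrow>
     conic_domain \<K> nx X \<and> conic_domain \<K> ny Y \<and>
     continuous_convex_concave nx X ny Y \<psi> \<and>
     (\<exists>nu \<Phi>. conic_representation \<K> nx X ny Y \<psi> nu \<Phi>)"


subsection \<open>Partial maximization\<close>

definition proj_fst :: "nat \<Rightarrow> nat \<Rightarrow> real Matrix.vec set \<Rightarrow> real Matrix.vec set" where
  "proj_fst nw nz Y = {w \<in> carrier_vec nw. \<exists>z\<in>carrier_vec nz. w @\<^sub>v z \<in> Y}"

definition partial_max ::
    "nat \<Rightarrow> real Matrix.vec set \<Rightarrow> (real Matrix.vec \<Rightarrow> real Matrix.vec \<Rightarrow> real) \<Rightarrow>
     real Matrix.vec \<Rightarrow> real Matrix.vec \<Rightarrow> real" where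
  "partial_max nz Y \<psi> x w = Sup {\<psi> x (w @\<^sub>v z) | z. z \<in> carrier_vec nz \<and> w @\<^sub>v z \<in> Y}"

end

theory Submission
  imports Defs
begin

text \<open>
  For fixed \<open>x\<close> and \<open>w\<close> the partial maximum is a max--inf, over the compact convex slice
  \<open>{z. [w;z] \<in> Y}\<close> and the convex set of feasible \<open>(g,h,\<tau>,u)\<close>, of the function
  \<open>g\<^sup>T w + h\<^sup>T z + \<tau>\<close>, which is affine in each argument; the minimax theorem exchanges the two.
  The inner problem \<open>max\<^sub>z h\<^sup>T z\<close> over the slice is then a conic program in \<open>(z,v)\<close>, which
  refined conic duality replaces by the minimum of \<open>(r - A w)\<^sup>T \<xi>\<close> over \<open>\<xi> \<ge> 0\<close>, \<open>B\<^sup>T \<xi> = h\<close>,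
  \<open>C\<^sup>T \<xi> = 0\<close>.

  Since the dimension is a variable, the separation theorems for Euclidean type classes do not
  apply to \<^term>\<open>carrier_vec n\<close>.  All separation is instead drawn from one sandwich form of the
  Hahn--Banach theorem, proved by adjoining one direction after the other: it is applied to a
  multiple of the gauge of an interior point of the cone (an exact penalty) for duality, to the
  support function of the slice for minimax, and to the \<open>l\<^sub>1\<close> norm for separating a point from
  a compact convex set.
\<close>

subsection \<open>Hahn--Banach for sublinear functions\<close>

text \<open>Essential strict feasibility gives an interior point only for the factor
  \<open>M\<close>; on the orthant factor the point may sit on the boundary, where a gauge could be
  infinite. Hence two kinds of multipliers: \<open>P x <= p\<close> stays a side condition while
  Hahn--Banach yields the multiplier of \<open>M\<close>, and the linear program that is left is
  dualised by Farkas' lemma. The sandwich is stated for a convex set of pairs \<open>(d, a)\<close>,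
  not for a concave function, because the sets fed into it are projections of feasible sets in which
  one \<open>d\<close> comes with many \<open>a\<close>. In the minimax step these pairs are slopes
  and offsets of affine functions of \<open>z\<close>: the functional that Hahn--Banach finds on the
  space of slopes is itself the point \<open>z\<close> sought, and being dominated by the support
  function places it in the slice. Compactness enters on the side of the slice; the infimum over
  \<open>(g, h, \<tau>, u)\<close> may fail to be attained. The identity is between extended reals.
  Its hard half argues at a real level \<open>c\<close> strictly between the two sides, which
  reduces it to real inequalities and also covers an infinite infimum.\<close>

definition sublinear_on :: "nat \<Rightarrow> (real Matrix.vec \<Rightarrow> real) \<Rightarrow> bool" where
  "sublinear_on n p \<longleftrightarrow>
     (\<forall>x\<in>carrier_vec n. \<forall>y\<in>carrier_vec n. p (x + y) \<le> p x + p y) \<and>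
     (\<forall>x\<in>carrier_vec n. \<forall>c\<ge>0. p (c \<cdot>\<^sub>v x) \<le> c * p x)"

lemma sublinear_onD:
  assumes "sublinear_on n p"
  shows sublinear_on_add: "\<lbrakk>x \<in> carrier_vec n; y \<in> carrier_vec n\<rbrakk> \<Longrightarrow> p (x + y) \<le> p x + p y"
    and sublinear_on_smult: "\<lbrakk>x \<in> carrier_vec n; 0 \<le> c\<rbrakk> \<Longrightarrow> p (c \<cdot>\<^sub>v x) \<le> c * p x"
  using assms by (auto simp: sublinear_on_def)

lemma sublinear_on_zero:
  assumes "sublinear_on n p"
  shows "p (0\<^sub>v n) = 0"
proof -
  have "p (0 \<cdot>\<^sub>v 0\<^sub>v n) \<le> 0 * p (0\<^sub>v n)"
    using assms by (intro sublinear_on_smult) auto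
  moreover have "p (0\<^sub>v n + 0\<^sub>v n) \<le> p (0\<^sub>v n) + p (0\<^sub>v n)"
    using assms by (intro sublinear_on_add) auto
  moreover have "(0::real) \<cdot>\<^sub>v 0\<^sub>v n = 0\<^sub>v n" by (intro eq_vecI) auto
  ultimately show ?thesis by simp
qed

lemma sublinear_on_uminus:
  assumes "sublinear_on n p" "x \<in> carrier_vec n"
  shows "- p (- x) \<le> p x"
proof -
  have "p (x + - x) \<le> p x + p (- x)"
    using assms by (intro sublinear_on_add) auto
  moreover have "x + - x = 0\<^sub>v n" using assms(2) by (intro eq_vecI) auto
  ultimately show ?thesis using sublinear_on_zero[OF assms(1)] by simp
qed

text \<open>The reverse inequality is the assumed one with factor \<open>inverse c\<close>, taken at
  the point \<open>c x\<close>.\<close>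

lemma sublinear_on_smult_eq:
  assumes p: "sublinear_on n p" and x: "x \<in> carrier_vec n" and c: "0 \<le> c"
  shows "p (c \<cdot>\<^sub>v x) = c * p x"
proof (cases "c = 0")
  case True
  then have "c \<cdot>\<^sub>v x = 0\<^sub>v n" using x by (intro eq_vecI) auto
  then show ?thesis using sublinear_on_zero[OF p] True by simp
next
  case False
  with c have c: "0 < c" by simp
  have "p (inverse c \<cdot>\<^sub>v (c \<cdot>\<^sub>v x)) \<le> inverse c * p (c \<cdot>\<^sub>v x)"
    using c x by (intro sublinear_on_smult[OF p]) auto
  moreover have "inverse c \<cdot>\<^sub>v (c \<cdot>\<^sub>v x) = x" using c x by (simp add: smult_smult_assoc)
  ultimately have "c * p x \<le> p (c \<cdot>\<^sub>v x)" using c by (simp add: field_simps)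
  with sublinear_on_smult[OF p x, of c] c show ?thesis by simp
qed

text \<open>\<open>p'\<close> is an infimal convolution of \<open>p\<close> with the cone
  \<open>T\<close>: at \<open>y = - d\<close> the vector cancels and only \<open>a\<close> remains,
  while \<open>T\<close> being closed under sums and scaling makes the infimum sublinear. It serves
  twice, with \<open>T\<close> a ray (one new direction) and with \<open>T\<close> the cone over a
  convex set.\<close>

lemma sublinear_on_sandwich_cone:
  assumes p: "sublinear_on n p"
    and T: "T \<subseteq> carrier_vec n \<times> (UNIV :: real set)" and T0: "(0\<^sub>v n, 0) \<in> T"
    and Tadd: "\<And>d a d' a'. \<lbrakk>(d, a) \<in> T; (d', a') \<in> T\<rbrakk> \<Longrightarrow> (d + d', a + a') \<in> T"
    and Tsmult: "\<And>d a c. \<lbrakk>(d, a) \<in> T; 0 \<le> c\<rbrakk> \<Longrightarrow> (c \<cdot>\<^sub>v d, c * a) \<in> T"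
    and ge: "\<And>d a. (d, a) \<in> T \<Longrightarrow> 0 \<le> p d + a"
  obtains p' where "sublinear_on n p'" "\<And>y. y \<in> carrier_vec n \<Longrightarrow> p' y \<le> p y"
    "\<And>d a. (d, a) \<in> T \<Longrightarrow> p' (- d) \<le> a"
proof
  define p' where "p' y = (INF (d, a)\<in>T. p (y + d) + a)" for y
  have Tc: "d \<in> carrier_vec n" if "(d, a) \<in> T" for d a using T that by auto
  \<comment> \<open>Writing \<open>d = - y + (y + d)\<close> bounds \<open>p d\<close> by
    \<open>p (- y) + p (y + d)\<close>, and \<open>ge\<close> turns this into a bound that does not
    depend on \<open>(d, a)\<close>.\<close>
  have bdd: "bdd_below ((\<lambda>(d, a). p (y + d) + a) ` T)" if y: "y \<in> carrier_vec n" for y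
  proof (rule bdd_belowI2[where m = "- p (- y)"])
    fix da assume "da \<in> T"
    then obtain d a where da: "da = (d, a)" "(d, a) \<in> T" by (cases da) auto
    have d: "d \<in> carrier_vec n" using Tc da by blast
    have "p (- y + (y + d)) \<le> p (- y) + p (y + d)"
      using p d y by (intro sublinear_on_add) auto
    moreover have "- y + (y + d) = d" using d y by (intro eq_vecI) auto
    ultimately show "- p (- y) \<le> (case da of (d, a) \<Rightarrow> p (y + d) + a)"
      using ge[OF da(2)] da by auto
  qed
  have le: "p' y \<le> p (y + d) + a" if "y \<in> carrier_vec n" "(d, a) \<in> T" for y d a
    unfolding p'_def using cINF_lower[OF bdd[OF that(1)] that(2)] by simp
  have greatest: "m \<le> p' y" if "\<And>d a. (d, a) \<in> T \<Longrightarrow> m \<le> p (y + d) + a" for m y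
    unfolding p'_def using that T0 by (intro cINF_greatest) auto
  show le_p: "p' y \<le> p y" if "y \<in> carrier_vec n" for y
    using le[OF that T0] that by simp
  show "p' (- d) \<le> a" if "(d, a) \<in> T" for d a
  proof -
    have d: "d \<in> carrier_vec n" using Tc that by blast
    then have "- d + d = 0\<^sub>v n" by (intro eq_vecI) auto
    then show ?thesis using le[of "- d" d a] that d sublinear_on_zero[OF p] by simp
  qed
  show "sublinear_on n p'"
    unfolding sublinear_on_def
  proof safe
    fix x y :: "real Matrix.vec" assume x: "x \<in> carrier_vec n" and y: "y \<in> carrier_vec n"
    have *: "p' (x + y) \<le> (p (x + d) + a) + (p (y + d') + a')"
      if T1: "(d, a) \<in> T" and T2: "(d', a') \<in> T" for d a d' a'
    proof -
      have d: "d \<in> carrier_vec n" "d' \<in> carrier_vec n" using Tc that by blast+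
      have "p' (x + y) \<le> p ((x + y) + (d + d')) + (a + a')"
        using Tadd[OF T1 T2] x y by (intro le) auto
      also have "(x + y) + (d + d') = (x + d) + (y + d')"
        using x y d by (intro eq_vecI) auto
      also have "p \<dots> \<le> p (x + d) + p (y + d')"
        using x y d p by (intro sublinear_on_add) auto
      finally show ?thesis by simp
    qed
    \<comment> \<open>The two infima are taken one after the other: over \<open>(d, a)\<close> with
      \<open>(d', a')\<close> fixed, then over \<open>(d', a')\<close>.\<close>
    have "p' (x + y) - (p (y + d') + a') \<le> p' x" if "(d', a') \<in> T" for d' a'
      using *[OF _ that] by (intro greatest) (simp add: algebra_simps)
    then have "p' (x + y) - p' x \<le> p' y"
      by (intro greatest) (simp add: algebra_simps)
    then show "p' (x + y) \<le> p' x + p' y" by simp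
  next
    fix x :: "real Matrix.vec" and c :: real assume x: "x \<in> carrier_vec n" and c: "0 \<le> c"
    show "p' (c \<cdot>\<^sub>v x) \<le> c * p' x"
    proof (cases "c = 0")
      case True
      then have "c \<cdot>\<^sub>v x = 0\<^sub>v n" using x by (intro eq_vecI) auto
      then show ?thesis using le_p[of "0\<^sub>v n"] sublinear_on_zero[OF p] True by simp
    next
      case False
      with c have c: "0 < c" by simp
      have "p' (c \<cdot>\<^sub>v x) / c \<le> p (x + d) + a" if da: "(d, a) \<in> T" for d a
      proof -
        have d: "d \<in> carrier_vec n" using Tc that by blast
        have "p' (c \<cdot>\<^sub>v x) \<le> p (c \<cdot>\<^sub>v x + c \<cdot>\<^sub>v d) + c * a"
          using Tsmult[OF da] x c by (intro le) auto
        also have "c \<cdot>\<^sub>v x + c \<cdot>\<^sub>v d = c \<cdot>\<^sub>v (x + d)"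
          using x d by (intro eq_vecI) (auto simp: algebra_simps)
        also have "p \<dots> \<le> c * p (x + d)"
          using x d c p by (intro sublinear_on_smult) auto
        finally show ?thesis using c by (simp add: field_simps)
      qed
      from greatest[OF this] show ?thesis using c by (simp add: field_simps)
    qed
  qed
qed

text \<open>For sublinear \<open>q\<close>, the inequality \<open>q (- e) <= - q e\<close> says that
  \<open>q\<close> is linear on the line through \<open>e\<close>. The induction achieves this for
  one coordinate axis at a time, lowering \<open>q\<close> in each round; after \<open>n\<close>
  rounds the values at the unit vectors are the coefficients of \<open>a\<close>.\<close>

lemma Hahn_Banach_sublinear_on:
  assumes p: "sublinear_on n p"
  obtains a where "a \<in> carrier_vec n" "\<And>x. x \<in> carrier_vec n \<Longrightarrow> a \<bullet> x \<le> p x"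
proof -
  have "\<exists>q. sublinear_on n q \<and> (\<forall>y\<in>carrier_vec n. q y \<le> p y) \<and>
          (\<forall>i<j. q (- unit_vec n i) \<le> - q (unit_vec n i))" if "j \<le> n" for j
    using that
  proof (induction j)
    case 0
    then show ?case using p by auto
  next
    case (Suc j)
    then obtain q where q: "sublinear_on n q" "\<forall>y\<in>carrier_vec n. q y \<le> p y"
      "\<forall>i<j. q (- unit_vec n i) \<le> - q (unit_vec n i)" by auto
    define e where "e = (unit_vec n j :: real Matrix.vec)"
    have e: "e \<in> carrier_vec n" by (simp add: e_def)
    \<comment> \<open>On the ray of \<open>(e, - q e)\<close> the sandwich hypothesis holds with
      equality. Its conclusion is \<open>q' (- e) <= - q e\<close>, and the right side is at most
      \<open>- q' e\<close> since \<open>q'\<close> lies below \<open>q\<close>.\<close>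
    define T where "T = {(c \<cdot>\<^sub>v e, - c * q e) | c. 0 \<le> c}"
    have T_I: "(d, a) \<in> T" if "d = c \<cdot>\<^sub>v e" "a = - c * q e" "0 \<le> c" for d a c
      using that by (auto simp: T_def)
    obtain q' where q': "sublinear_on n q'" "\<And>y. y \<in> carrier_vec n \<Longrightarrow> q' y \<le> q y"
      "\<And>d a. (d, a) \<in> T \<Longrightarrow> q' (- d) \<le> a"
    proof (rule sublinear_on_sandwich_cone[OF q(1), of T])
      show "T \<subseteq> carrier_vec n \<times> UNIV" using e by (auto simp: T_def)
      show "(0\<^sub>v n, 0) \<in> T" using e by (intro T_I[of _ 0]) auto
      show "(d + d', a + a') \<in> T" if d: "(d, a) \<in> T" "(d', a') \<in> T" for d a d' a'
      proof -
        obtain c c' where "d = c \<cdot>\<^sub>v e" "a = - c * q e" "0 \<le> c" "d' = c' \<cdot>\<^sub>v e" "a' = - c' * q e" "0 \<le> c'"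
          using d by (auto simp: T_def)
        then show ?thesis
          by (intro T_I[of _ "c + c'"]) (auto simp: add_smult_distrib_vec algebra_simps)
      qed
      show "(b \<cdot>\<^sub>v d, b * a) \<in> T" if d: "(d, a) \<in> T" "0 \<le> b" for d a b
      proof -
        obtain c where "d = c \<cdot>\<^sub>v e" "a = - c * q e" "0 \<le> c"
          using d by (auto simp: T_def)
        then show ?thesis using d(2)
          by (intro T_I[of _ "b * c"]) (auto simp: smult_smult_assoc)
      qed
      show "0 \<le> q d + a" if "(d, a) \<in> T" for d a
        using that sublinear_on_smult_eq[OF q(1) e] by (auto simp: T_def)
    qed blast
    show ?case
    proof (intro exI[of _ q'] conjI allI impI ballI)
      fix i assume i: "i < Suc j"
      show "q' (- unit_vec n i) \<le> - q' (unit_vec n i)"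
      proof (cases "i = j")
        case True
        have "(e, - q e) \<in> T" using e by (intro T_I[of _ 1]) auto
        from q'(3)[OF this] have "q' (- e) \<le> - q e" .
        then show ?thesis using q'(2)[OF e] True by (simp add: e_def)
      next
        case False
        \<comment> \<open>Linearity along earlier axes survives: passing from \<open>q\<close> to
          \<open>q'\<close> lowers the left side and raises the right side.\<close>
        with i have "q (- unit_vec n i) \<le> - q (unit_vec n i)" using q(3) by auto
        then show ?thesis using q'(2)[of "- unit_vec n i"] q'(2)[of "unit_vec n i"] by simp
      qed
    qed (use q' q(2) in force)+
  qed
  from this[of n] obtain q where q: "sublinear_on n q" "\<And>y. y \<in> carrier_vec n \<Longrightarrow> q y \<le> p y"
    "\<And>i. i < n \<Longrightarrow> q (- unit_vec n i) \<le> - q (unit_vec n i)" by auto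
  define a where "a = Matrix.vec n (\<lambda>i. q (unit_vec n i))"
  have a: "a \<in> carrier_vec n" by (simp add: a_def)
  have unit: "q (c \<cdot>\<^sub>v unit_vec n i) \<le> c * a $ i" if i: "i < n" for i c
  proof (cases "0 \<le> c")
    case True
    then show ?thesis using sublinear_on_smult[OF q(1), of "unit_vec n i" c] i by (simp add: a_def)
  next
    case False
    then have "q ((- c) \<cdot>\<^sub>v (- unit_vec n i)) \<le> (- c) * q (- unit_vec n i)"
      by (intro sublinear_on_smult[OF q(1)]) auto
    also have "\<dots> \<le> (- c) * (- q (unit_vec n i))"
      using False q(3)[OF i] by (intro mult_left_mono) auto
    also have "(- c) \<cdot>\<^sub>v (- unit_vec n i) = c \<cdot>\<^sub>v unit_vec n i" by (intro eq_vecI) auto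
    finally show ?thesis using i by (simp add: a_def)
  qed
  have partial: "q (Matrix.vec n (\<lambda>i. if i < j then x $ i else 0)) \<le> (\<Sum>i<j. x $ i * a $ i)"
    if "j \<le> n" for x j
    using that
  proof (induction j)
    case 0
    have "Matrix.vec n (\<lambda>i. 0::real) = 0\<^sub>v n" by (intro eq_vecI) auto
    then show ?case using sublinear_on_zero[OF q(1)] by simp
  next
    case (Suc j)
    have "Matrix.vec n (\<lambda>i. if i < Suc j then x $ i else 0)
        = Matrix.vec n (\<lambda>i. if i < j then x $ i else 0) + x $ j \<cdot>\<^sub>v unit_vec n j"
      using Suc.prems by (intro eq_vecI) (auto simp: less_Suc_eq)
    then have "q (Matrix.vec n (\<lambda>i. if i < Suc j then x $ i else 0))
        \<le> q (Matrix.vec n (\<lambda>i. if i < j then x $ i else 0)) + q (x $ j \<cdot>\<^sub>v unit_vec n j)"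
      using sublinear_on_add[OF q(1)] by auto
    then show ?case using Suc unit[of j "x $ j"] by simp
  qed
  \<comment> \<open>This upper bound suffices: read at \<open>- x\<close> it says that
    \<open>a x\<close> is at most \<open>- q (- x)\<close>, hence at most
    \<open>q x\<close>.\<close>
  have "q x \<le> a \<bullet> x" if x: "x \<in> carrier_vec n" for x
  proof -
    have "Matrix.vec n (\<lambda>i. if i < n then x $ i else 0) = x"
      using x by (intro eq_vecI) auto
    then show ?thesis using partial[of n x] x
      by (simp add: scalar_prod_def lessThan_atLeast0 mult.commute)
  qed
  then have "q (- x) \<le> - (a \<bullet> x)" if "x \<in> carrier_vec n" for x
    using that a by (metis scalar_prod_uminus_right carrier_vecD uminus_carrier_vec)
  then have "a \<bullet> x \<le> p x" if "x \<in> carrier_vec n" for x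
    using q(2)[OF that] sublinear_on_uminus[OF q(1) that] that by force
  with a show thesis by (rule that)
qed

text \<open>Pass from \<open>D\<close> to the cone over it and from \<open>p\<close> to the smaller
  function \<open>p'\<close> of the cone version. Any linear functional below \<open>p'\<close> then
  satisfies both bounds, the second one because \<open>p' (- d) <= a\<close>.\<close>

lemma Hahn_Banach_sandwich:
  assumes p: "sublinear_on n p"
    and D: "D \<subseteq> carrier_vec n \<times> (UNIV :: real set)"
    and conv: "\<And>d a d' a' s t. \<lbrakk>(d, a) \<in> D; (d', a') \<in> D; 0 \<le> s; 0 \<le> t; s + t = 1\<rbrakk>
      \<Longrightarrow> (s \<cdot>\<^sub>v d + t \<cdot>\<^sub>v d', s * a + t * a') \<in> D"
    and ge: "\<And>d a. (d, a) \<in> D \<Longrightarrow> 0 \<le> p d + a"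
  obtains b where "b \<in> carrier_vec n" "\<And>y. y \<in> carrier_vec n \<Longrightarrow> b \<bullet> y \<le> p y"
    "\<And>d a. (d, a) \<in> D \<Longrightarrow> - (b \<bullet> d) \<le> a"
proof (cases "D = {}")
  case True
  then show thesis using Hahn_Banach_sublinear_on[OF p] that by blast
next
  case False
  then obtain d0 a0 where da0: "(d0, a0) \<in> D" by auto
  have Dc: "d \<in> carrier_vec n" if "(d, a) \<in> D" for d a using D that by auto
  define T where "T = {(c \<cdot>\<^sub>v d, c * a) | c d a. 0 \<le> c \<and> (d, a) \<in> D}"
  have T_I: "(e, b) \<in> T" if "e = c \<cdot>\<^sub>v d" "b = c * a" "0 \<le> c" "(d, a) \<in> D" for e b c d a
    using that by (auto simp: T_def)
  obtain p' where p': "sublinear_on n p'" "\<And>y. y \<in> carrier_vec n \<Longrightarrow> p' y \<le> p y"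
    "\<And>d a. (d, a) \<in> T \<Longrightarrow> p' (- d) \<le> a"
  proof (rule sublinear_on_sandwich_cone[OF p, of T])
    show "T \<subseteq> carrier_vec n \<times> UNIV" using D by (auto simp: T_def)
    show "(0\<^sub>v n, 0) \<in> T"
      using Dc[OF da0] by (intro T_I[OF _ _ _ da0, of _ 0]) auto
    show "(e + e', b + b') \<in> T" if e: "(e, b) \<in> T" "(e', b') \<in> T" for e b e' b'
    proof -
      obtain c d a where 1: "e = c \<cdot>\<^sub>v d" "b = c * a" "0 \<le> c" "(d, a) \<in> D"
        using e(1) by (auto simp: T_def)
      obtain c' d' a' where 2: "e' = c' \<cdot>\<^sub>v d'" "b' = c' * a'" "0 \<le> c'" "(d', a') \<in> D"
        using e(2) by (auto simp: T_def)
      note d = Dc[OF 1(4)] Dc[OF 2(4)]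
      show ?thesis
      \<comment> \<open>A sum of two scaled points is the total weight \<open>k\<close> times a
        convex combination. For total weight \<open>0\<close> there is no such combination, and
        \<open>0\<close> times any point of \<open>D\<close> serves.\<close>
      proof (cases "c + c' = 0")
        case True
        then have "c = 0" "c' = 0" using 1(3) 2(3) by auto
        then show ?thesis
          using 1 2 d by (intro T_I[of _ 0 d _ a]) auto
      next
        case False
        define k where "k = c + c'"
        have k: "0 < k" "c = k * (c / k)" "c' = k * (c' / k)"
          using False 1(3) 2(3) by (auto simp: k_def)
        have sum1: "c / k + c' / k = 1"
          using k(1) by (simp add: k_def add_divide_distrib[symmetric])
        show ?thesis
        proof (rule T_I[of _ k "(c / k) \<cdot>\<^sub>v d + (c' / k) \<cdot>\<^sub>v d'" _ "(c / k) * a + (c' / k) * a'"])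
          show "e + e' = k \<cdot>\<^sub>v ((c / k) \<cdot>\<^sub>v d + (c' / k) \<cdot>\<^sub>v d')"
            using 1 2 d k by (intro eq_vecI) (auto simp: field_simps)
          show "b + b' = k * (c / k * a + c' / k * a')"
            using 1 2 k by (simp add: field_simps)
          show "(c / k \<cdot>\<^sub>v d + c' / k \<cdot>\<^sub>v d', c / k * a + c' / k * a') \<in> D"
            using 1 2 k sum1 by (intro conv) auto
        qed (use k in simp)
      qed
    qed
    show "(s \<cdot>\<^sub>v e, s * b) \<in> T" if e: "(e, b) \<in> T" "0 \<le> s" for e b s
    proof -
      obtain c d a where "e = c \<cdot>\<^sub>v d" "b = c * a" "0 \<le> c" "(d, a) \<in> D"
        using e(1) by (auto simp: T_def)
      then show ?thesis using e(2)
        by (intro T_I[of _ "s * c" d _ a]) (auto simp: smult_smult_assoc)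
    qed
    show "0 \<le> p e + b" if e: "(e, b) \<in> T" for e b
    proof -
      obtain c d a where 1: "e = c \<cdot>\<^sub>v d" "b = c * a" "0 \<le> c" "(d, a) \<in> D"
        using e(1) by (auto simp: T_def)
      have "p e + b = c * (p d + a)"
        using 1 sublinear_on_smult_eq[OF p Dc[OF 1(4)] 1(3)] by (simp add: algebra_simps)
      then show ?thesis using 1(3) ge[OF 1(4)] by simp
    qed
  qed blast
  obtain b where b: "b \<in> carrier_vec n" "\<And>x. x \<in> carrier_vec n \<Longrightarrow> b \<bullet> x \<le> p' x"
    using Hahn_Banach_sublinear_on[OF p'(1)] by blast
  show thesis
  proof (rule that[OF b(1)])
    show "b \<bullet> y \<le> p y" if "y \<in> carrier_vec n" for y
      using b(2)[OF that] p'(2)[OF that] by simp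
    show "- (b \<bullet> d) \<le> a" if da: "(d, a) \<in> D" for d a
    proof -
      have "(d, a) \<in> T" using da by (intro T_I[OF _ _ _ da, of _ 1]) auto
      from p'(3)[OF this] have "b \<bullet> (- d) \<le> a"
        using b(2)[of "- d"] Dc[OF da] by simp
      then show ?thesis using b(1) Dc[OF da] by simp
    qed
  qed
qed

text \<open>Induction on the number of functionals. If the first \<open>m\<close> already force
  \<open>c x <= 0\<close>, the new multiplier is \<open>0\<close>. Otherwise some \<open>x1\<close>
  violates this, so \<open>a m\<close> must be positive there, and its rescaling \<open>y\<close>
  splits the space into the line of \<open>y\<close> and the kernel of \<open>a m\<close>. The
  conclusion is tested on vectors \<open>x\<close> so that no sums of vectors arise.\<close>

lemma Farkas_vec:
  fixes a :: "nat \<Rightarrow> real Matrix.vec"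
  assumes "\<And>i. i < m \<Longrightarrow> a i \<in> carrier_vec n" "c \<in> carrier_vec n"
    and "\<And>x. \<lbrakk>x \<in> carrier_vec n; \<And>i. i < m \<Longrightarrow> a i \<bullet> x \<le> 0\<rbrakk> \<Longrightarrow> c \<bullet> x \<le> 0"
  shows "\<exists>lam. (\<forall>i<m. 0 \<le> lam i) \<and> (\<forall>x\<in>carrier_vec n. c \<bullet> x = (\<Sum>i<m. lam i * (a i \<bullet> x)))"
  using assms
proof (induction m arbitrary: a c)
  case 0
  have "c \<bullet> x = 0" if x: "x \<in> carrier_vec n" for x
  proof -
    have "c \<bullet> (- x) \<le> 0" by (rule "0.prems"(3)) (use x in auto)
    moreover have "c \<bullet> (- x) = - (c \<bullet> x)" using "0.prems"(2) x by simp
    moreover have "c \<bullet> x \<le> 0" by (rule "0.prems"(3)) (use x in auto)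
    ultimately show ?thesis by linarith
  qed
  then show ?case by simp
next
  case (Suc m)
  show ?case
  proof (cases "\<forall>x\<in>carrier_vec n. (\<forall>i<m. a i \<bullet> x \<le> 0) \<longrightarrow> c \<bullet> x \<le> 0")
    case True
    have "\<exists>lam. (\<forall>i<m. 0 \<le> lam i) \<and>
        (\<forall>x\<in>carrier_vec n. c \<bullet> x = (\<Sum>i<m. lam i * (a i \<bullet> x)))"
      by (rule Suc.IH) (use Suc.prems True in auto)
    then obtain lam where lam: "\<forall>i<m. 0 \<le> lam i"
      "\<forall>x\<in>carrier_vec n. c \<bullet> x = (\<Sum>i<m. lam i * (a i \<bullet> x))"
      by blast
    then show ?thesis by (intro exI[of _ "lam(m := 0)"]) simp
  next
    case False
    then obtain x1 where x1: "x1 \<in> carrier_vec n" "\<And>i. i < m \<Longrightarrow> a i \<bullet> x1 \<le> 0" "0 < c \<bullet> x1"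
      by force
    have am: "a m \<in> carrier_vec n" "\<And>i. i < m \<Longrightarrow> a i \<in> carrier_vec n" using Suc.prems(1) by auto
    have pos: "0 < a m \<bullet> x1"
    proof (rule ccontr)
      assume "\<not> ?thesis"
      then have "c \<bullet> x1 \<le> 0" using x1 by (intro Suc.prems(3)) (auto simp: less_Suc_eq)
      with x1 show False by simp
    qed
    define y where "y = inverse (a m \<bullet> x1) \<cdot>\<^sub>v x1"
    have y: "y \<in> carrier_vec n" "\<And>i. i < m \<Longrightarrow> a i \<bullet> y \<le> 0" "0 < c \<bullet> y" "a m \<bullet> y = 1"
      using x1 pos Suc.prems(2) am by (auto simp: y_def mult_nonneg_nonpos)
    \<comment> \<open>Bartl's elimination: the new functionals vanish at \<open>y\<close>.\<close>
    define a' where "a' i = a i - (a i \<bullet> y) \<cdot>\<^sub>v a m" for i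
    define c' where "c' = c - (c \<bullet> y) \<cdot>\<^sub>v a m"
    have a': "a' i \<in> carrier_vec n" if "i < m" for i using am that by (simp add: a'_def)
    have c': "c' \<in> carrier_vec n" using am Suc.prems(2) by (simp add: c'_def)
    have a'x: "a' i \<bullet> x = a i \<bullet> x - (a i \<bullet> y) * (a m \<bullet> x)"
      if "x \<in> carrier_vec n" "i < m" for x i
      using that am by (simp add: a'_def minus_scalar_prod_distrib[of _ n])
    have c'x: "c' \<bullet> x = c \<bullet> x - (c \<bullet> y) * (a m \<bullet> x)" if "x \<in> carrier_vec n" for x
      using that am Suc.prems(2) by (simp add: c'_def minus_scalar_prod_distrib[of _ n])
    have "c' \<bullet> x \<le> 0" if x: "x \<in> carrier_vec n" and le: "\<And>i. i < m \<Longrightarrow> a' i \<bullet> x \<le> 0" for x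
    proof -
      \<comment> \<open>\<open>z\<close> is the projection of \<open>x\<close> along
        \<open>y\<close> onto the kernel of \<open>a m\<close>. The original functionals take at
        \<open>z\<close> the values of the reduced ones at \<open>x\<close>, so the hypothesis on
        \<open>c\<close> applies to \<open>z\<close>.\<close>
      define z where "z = x - (a m \<bullet> x) \<cdot>\<^sub>v y"
      have z: "z \<in> carrier_vec n" using x y by (simp add: z_def)
      have prod_z: "b \<bullet> z = b \<bullet> x - (a m \<bullet> x) * (b \<bullet> y)" if "b \<in> carrier_vec n" for b
        using that x y by (simp add: z_def scalar_prod_minus_distrib[of _ n])
      have "a i \<bullet> z \<le> 0" if "i < Suc m" for i
      proof (cases "i = m")
        case True
        then show ?thesis using prod_z[OF am(1)] y by simp
      next
        case False
        with that have i: "i < m" by simp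
        show ?thesis using le[OF i] a'x[OF x i] prod_z[OF am(2)[OF i]] by (simp add: mult.commute)
      qed
      with z have "c \<bullet> z \<le> 0" by (intro Suc.prems(3))
      then show ?thesis using prod_z[OF Suc.prems(2)] c'x[OF x] by (simp add: mult.commute)
    qed
    then obtain lam where lam: "\<forall>i<m. 0 \<le> lam i"
      "\<forall>x\<in>carrier_vec n. c' \<bullet> x = (\<Sum>i<m. lam i * (a' i \<bullet> x))"
      using Suc.IH[of a' c'] a' c' by blast
    \<comment> \<open>\<open>\<mu>\<close> is the total coefficient of \<open>a m\<close> after
      expanding \<open>a'\<close> and \<open>c'\<close>. It is nonnegative because
      \<open>a i y <= 0\<close> for \<open>i < m\<close> and \<open>c y > 0\<close>.\<close>
    define \<mu> where "\<mu> = c \<bullet> y - (\<Sum>i<m. lam i * (a i \<bullet> y))"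
    have "0 \<le> \<mu>"
      using lam(1) y by (auto simp: \<mu>_def intro!: order_trans[OF sum_nonpos] mult_nonneg_nonpos)
    moreover have "c \<bullet> x = (\<Sum>i<m. lam i * (a i \<bullet> x)) + \<mu> * (a m \<bullet> x)" if x: "x \<in> carrier_vec n" for x
    proof -
      have "c \<bullet> x = c' \<bullet> x + (c \<bullet> y) * (a m \<bullet> x)" using c'x[OF x] by simp
      also have "c' \<bullet> x = (\<Sum>i<m. lam i * (a i \<bullet> x - (a i \<bullet> y) * (a m \<bullet> x)))"
        using lam(2) x a'x[OF x] by simp
      also have "\<dots> = (\<Sum>i<m. lam i * (a i \<bullet> x)) - (\<Sum>i<m. lam i * (a i \<bullet> y)) * (a m \<bullet> x)"
        by (simp add: right_diff_distrib sum_subtractf sum_distrib_right mult.assoc)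
      finally show ?thesis by (simp add: \<mu>_def algebra_simps)
    qed
    ultimately show ?thesis using lam(1)
      by (intro exI[of _ "lam(m := \<mu>)"]) (auto simp: less_Suc_eq)
  qed
qed

lemma vec_eqI_scalar_prod:
  fixes a b :: "real Matrix.vec"
  assumes "a \<in> carrier_vec n" "b \<in> carrier_vec n" "\<And>x. x \<in> carrier_vec n \<Longrightarrow> a \<bullet> x = b \<bullet> x"
  shows "a = b"
proof (rule eq_vecI)
  show "a $ i = b $ i" if "i < dim_vec b" for i
    using assms(3)[of "unit_vec n i"] that assms(1,2) by simp
qed (use assms in auto)

lemma transpose_mult_scalar_prod:
  fixes A :: "real mat"
  assumes "A \<in> carrier_mat m n" "y \<in> carrier_vec m" "x \<in> carrier_vec n"
  shows "(transpose_mat A *\<^sub>v y) \<bullet> x = y \<bullet> (A *\<^sub>v x)"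
  using transpose_vec_mult_scalar[OF assms(1,3,2)] assms
  by (metis comm_scalar_prod mult_mat_vec_carrier transpose_carrier_mat)

text \<open>Homogenisation: with a new first coordinate \<open>t\<close> the data become
  \<open>P x <= t p\<close>, \<open>- t <= 0\<close> and \<open>h x <= t c\<close>. The multiplier
  of the row \<open>- t <= 0\<close> is the gap between \<open>lam p\<close> and \<open>c\<close>,
  hence only an inequality in the last conclusion.\<close>

lemma Farkas_affine:
  fixes P :: "real mat"
  assumes P: "P \<in> carrier_mat k n" and p: "p \<in> carrier_vec k" and h: "h \<in> carrier_vec n"
    and x0: "x0 \<in> carrier_vec n" "P *\<^sub>v x0 \<le> p"
    and bound: "\<And>x. \<lbrakk>x \<in> carrier_vec n; P *\<^sub>v x \<le> p\<rbrakk> \<Longrightarrow> h \<bullet> x \<le> c"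
  obtains lam where "lam \<in> nonneg_orthant k" "transpose_mat P *\<^sub>v lam = h" "lam \<bullet> p \<le> c"
proof -
  have feas: "P *\<^sub>v x \<le> p \<longleftrightarrow> (\<forall>i<k. row P i \<bullet> x \<le> p $ i)" for x
    using P p by (auto simp: less_eq_vec_def)
  have rowP: "row P i \<in> carrier_vec n" if "i < k" for i using P that by simp
  define a where "a i = (if i < k then vCons (- (p $ i)) (row P i) else vCons (- 1) (0\<^sub>v n))" for i
  have "\<exists>lam. (\<forall>i<Suc k. 0 \<le> lam i) \<and>
      (\<forall>x\<in>carrier_vec (Suc n). vCons (- c) h \<bullet> x = (\<Sum>i<Suc k. lam i * (a i \<bullet> x)))"
  proof (rule Farkas_vec)
    show "a i \<in> carrier_vec (Suc n)" if "i < Suc k" for i using P that by (simp add: a_def)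
    show "vCons (- c) h \<in> carrier_vec (Suc n)" using h by simp
    fix y assume y: "y \<in> carrier_vec (Suc n)" and le: "\<And>i. i < Suc k \<Longrightarrow> a i \<bullet> y \<le> 0"
    obtain t x where tx: "y = vCons t x" using y by (cases y) auto
    have x: "x \<in> carrier_vec n" using y tx by simp
    have t: "0 \<le> t" using le[of k] x by (simp add: a_def tx)
    have le': "row P i \<bullet> x \<le> t * p $ i" if "i < k" for i
      using le[of i] that by (simp add: a_def tx mult.commute)
    have "h \<bullet> x \<le> t * c"
    proof (cases "t = 0")
      case False
      with t have t: "0 < t" by simp
      have "P *\<^sub>v (inverse t \<cdot>\<^sub>v x) \<le> p"
        unfolding feas
      proof safe
        fix i assume i: "i < k"
        have "row P i \<bullet> (inverse t \<cdot>\<^sub>v x) = inverse t * (row P i \<bullet> x)"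
          using rowP[OF i] x by simp
        also have "\<dots> \<le> inverse t * (t * p $ i)"
          using le'[OF i] t by (intro mult_left_mono) auto
        also have "\<dots> = p $ i" using t by simp
        finally show "row P i \<bullet> (inverse t \<cdot>\<^sub>v x) \<le> p $ i" .
      qed
      then have "h \<bullet> (inverse t \<cdot>\<^sub>v x) \<le> c" using x by (intro bound) auto
      then have "inverse t * (h \<bullet> x) \<le> c" using h x by simp
      then show ?thesis using t by (simp add: field_simps)
    next
      case True
      \<comment> \<open>For \<open>t = 0\<close> the vector \<open>x\<close> is a recession
        direction of the polyhedron, so the whole ray from \<open>x0\<close> is feasible and
        \<open>h\<close> must not grow along it.\<close>
      have *: "h \<bullet> x0 + s * (h \<bullet> x) \<le> c" if s: "0 \<le> s" for s
      proof -
        have "P *\<^sub>v (x0 + s \<cdot>\<^sub>v x) \<le> p"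
          unfolding feas
        proof safe
          fix i assume i: "i < k"
          have "row P i \<bullet> (x0 + s \<cdot>\<^sub>v x) = row P i \<bullet> x0 + s * (row P i \<bullet> x)"
            using rowP[OF i] x x0 by (simp add: scalar_prod_add_distrib[of _ n])
          moreover have "s * (row P i \<bullet> x) \<le> 0"
            using le'[OF i] True s by (simp add: mult_nonneg_nonpos)
          ultimately show "row P i \<bullet> (x0 + s \<cdot>\<^sub>v x) \<le> p $ i" using x0(2) i unfolding feas by force
        qed
        then have "h \<bullet> (x0 + s \<cdot>\<^sub>v x) \<le> c" using x x0 by (intro bound) auto
        then show ?thesis using h x x0 by (simp add: scalar_prod_add_distrib[of _ n])
      qed
      have "h \<bullet> x \<le> 0"
      proof (rule ccontr)
        assume "\<not> ?thesis"
        then have pos: "0 < h \<bullet> x" by simp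
        have "h \<bullet> x0 \<le> c" using *[of 0] by simp
        \<comment> \<open>At this step length the objective equals \<open>c + 1\<close>.\<close>
        then show False using *[of "(c - h \<bullet> x0 + 1) / (h \<bullet> x)"] pos by (simp add: field_simps)
      qed
      then show ?thesis using True by simp
    qed
    then show "vCons (- c) h \<bullet> y \<le> 0" by (simp add: tx mult.commute)
  qed
  then obtain lam where lam: "\<And>i. i < Suc k \<Longrightarrow> 0 \<le> lam i"
    "\<And>x. x \<in> carrier_vec (Suc n) \<Longrightarrow> vCons (- c) h \<bullet> x = (\<Sum>i<Suc k. lam i * (a i \<bullet> x))"
    by blast
  define v where "v = Matrix.vec k lam"
  have v: "v \<in> carrier_vec k" by (simp add: v_def)
  show thesis
  proof (rule that[of v])
    show "v \<in> nonneg_orthant k" using lam(1) by (simp add: nonneg_orthant_def v_def)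
    \<comment> \<open>The point \<open>(1, 0)\<close> isolates the constant terms of the identity;
      \<open>(0, x)\<close>, used below, isolates the linear ones.\<close>
    have "vCons (- c) h \<bullet> vCons 1 (0\<^sub>v n) = (\<Sum>i<Suc k. lam i * (a i \<bullet> vCons 1 (0\<^sub>v n)))"
      by (intro lam(2)) simp
    then have "c = (\<Sum>i<k. lam i * p $ i) + lam k"
      using h rowP by (simp add: a_def sum_negf)
    moreover have "v \<bullet> p = (\<Sum>i<k. lam i * p $ i)"
      using p by (simp add: scalar_prod_def v_def lessThan_atLeast0)
    ultimately show "v \<bullet> p \<le> c" using lam(1)[of k] by simp
    show "transpose_mat P *\<^sub>v v = h"
    proof (rule vec_eqI_scalar_prod)
      fix x :: "real Matrix.vec" assume x: "x \<in> carrier_vec n"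
      have "(transpose_mat P *\<^sub>v v) \<bullet> x = v \<bullet> (P *\<^sub>v x)"
        using P v x by (rule transpose_mult_scalar_prod)
      also have "\<dots> = (\<Sum>i<k. lam i * (row P i \<bullet> x))"
        using P unfolding scalar_prod_def[of v "P *\<^sub>v x"] by (simp add: v_def lessThan_atLeast0)
      also have "\<dots> = h \<bullet> x"
        using lam(2)[of "vCons 0 x"] x by (simp add: a_def)
      finally show "(transpose_mat P *\<^sub>v v) \<bullet> x = h \<bullet> x" .
    qed (use P v h in auto)
  qed
qed

subsection \<open>Conic duality\<close>

lemma topspace_vec_topology [simp]: "topspace (vec_topology n) = carrier_vec n"
  by (auto simp: vec_topology_def topspace_pullback_topology)

lemma continuous_map_vec_index:
  assumes "i < n"
  shows "continuous_map (vec_topology n) euclideanreal (\<lambda>x. x $ i)"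
proof -
  have "continuous_map (vec_topology n) euclideanreal
      ((\<lambda>f. f i) \<circ> (\<lambda>x::real Matrix.vec. \<lambda>i\<in>{..<n}. x $ i))"
    unfolding vec_topology_def
    using assms by (intro continuous_map_pullback continuous_map_product_projection) simp
  then show ?thesis using assms by (simp add: comp_def)
qed

lemma continuous_map_into_vec_topology:
  assumes "\<And>x. x \<in> topspace T \<Longrightarrow> f x \<in> carrier_vec n"
    and "\<And>i. i < n \<Longrightarrow> continuous_map T euclideanreal (\<lambda>x. f x $ i)"
  shows "continuous_map T (vec_topology n) f"
  unfolding vec_topology_def
proof (rule continuous_map_pullback')
  show "continuous_map T (powertop_real {..<n}) ((\<lambda>x. \<lambda>i\<in>{..<n}. x $ i) \<circ> f)"
    using assms(2) by (auto simp: continuous_map_componentwise comp_def)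
  show "topspace T \<subseteq> f -` carrier_vec n" using assms(1) by auto
qed

lemma continuous_map_scalar_prod:
  assumes "a \<in> carrier_vec n"
  shows "continuous_map (vec_topology n) euclideanreal (\<lambda>x. a \<bullet> x)"
proof -
  have "continuous_map (vec_topology n) euclideanreal (\<lambda>x. \<Sum>i<n. a $ i * x $ i)"
    by (intro continuous_map_sum continuous_map_real_mult continuous_map_vec_index) auto
  then show ?thesis
    by (rule continuous_map_eq) (auto simp: scalar_prod_def lessThan_atLeast0)
qed

section \<open>Regular cones and the gauge of an interior point\<close>

lemma regular_coneD:
  assumes "regular_cone m M"
  shows regular_cone_carrier: "M \<subseteq> carrier_vec m"
    and regular_cone_smult: "\<lbrakk>x \<in> M; 0 \<le> c\<rbrakk> \<Longrightarrow> c \<cdot>\<^sub>v x \<in> M"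
    and regular_cone_convex: "vec_convex M"
  using assms by (auto simp: regular_cone_def)

lemma regular_cone_add:
  assumes M: "regular_cone m M" and "x \<in> M" "y \<in> M"
  shows "x + y \<in> M"
proof -
  have c: "x \<in> carrier_vec m" "y \<in> carrier_vec m"
    using regular_cone_carrier[OF M] assms(2,3) by auto
  have "(1/2) \<cdot>\<^sub>v x + (1/2) \<cdot>\<^sub>v y \<in> M"
    using regular_cone_convex[OF M] assms(2,3) by (auto simp: vec_convex_def)
  then have "2 \<cdot>\<^sub>v ((1/2) \<cdot>\<^sub>v x + (1/2) \<cdot>\<^sub>v y) \<in> M"
    using regular_cone_smult[OF M, of _ 2] by simp
  moreover have "2 \<cdot>\<^sub>v ((1/2) \<cdot>\<^sub>v x + (1/2) \<cdot>\<^sub>v y) = x + y"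
    using c by (intro eq_vecI) auto
  ultimately show ?thesis by simp
qed

lemma regular_cone_zero:
  assumes M: "regular_cone m M"
  shows "0\<^sub>v m \<in> M"
proof -
  obtain x where x: "x \<in> M"
    using M interior_of_subset[of "vec_topology m" M] by (auto simp: regular_cone_def)
  then have "0 \<cdot>\<^sub>v x \<in> M" using regular_cone_smult[OF M x, of 0] by simp
  moreover have "0 \<cdot>\<^sub>v x = 0\<^sub>v m" using regular_cone_carrier[OF M] x by (intro eq_vecI) auto
  ultimately show ?thesis by simp
qed

text \<open>An interior point is an order unit: \<open>s + (e / 2) y\<close> is still in the cone
  for some \<open>e > 0\<close>, and multiplying by \<open>2 / e\<close> gives the claim. This makes
  the gauge below finite in every direction.\<close>

lemma interior_cone_order_unit:
  assumes M: "regular_cone m M" and s: "s \<in> vec_topology m interior_of M"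
    and y: "y \<in> carrier_vec m"
  obtains t where "0 \<le> t" "t \<cdot>\<^sub>v s + y \<in> M"
proof -
  let ?I = "vec_topology m interior_of M"
  have sc: "s \<in> carrier_vec m"
    using s interior_of_subset[of "vec_topology m" M] regular_cone_carrier[OF M] by blast
  have "continuous_map euclideanreal (vec_topology m) (\<lambda>e. s + e \<cdot>\<^sub>v y)"
    using sc y by (intro continuous_map_into_vec_topology)
      (auto simp: continuous_map_iff_continuous intro!: continuous_intros)
  then have "open {e. s + e \<cdot>\<^sub>v y \<in> ?I}"
    using openin_continuous_map_preimage[of euclideanreal "vec_topology m" "\<lambda>e. s + e \<cdot>\<^sub>v y" ?I]
    by simp
  moreover have "s + 0 \<cdot>\<^sub>v y = s" using sc y by (intro eq_vecI) auto
  ultimately obtain e where e: "0 < e" "ball 0 e \<subseteq> {e. s + e \<cdot>\<^sub>v y \<in> ?I}"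
    using s by (metis (no_types, lifting) mem_Collect_eq open_contains_ball)
  have "e / 2 \<in> ball 0 e" using e(1) by simp
  with e have "s + (e / 2) \<cdot>\<^sub>v y \<in> M"
    using interior_of_subset[of "vec_topology m" M] by blast
  then have "(2 / e) \<cdot>\<^sub>v (s + (e / 2) \<cdot>\<^sub>v y) \<in> M"
    using e(1) by (intro regular_cone_smult[OF M]) auto
  moreover have "(2 / e) \<cdot>\<^sub>v (s + (e / 2) \<cdot>\<^sub>v y) = (2 / e) \<cdot>\<^sub>v s + y"
    using sc y e(1) by (intro eq_vecI) (auto simp: field_simps)
  ultimately show thesis using that[of "2 / e"] e(1) by simp
qed

text \<open>The order-unit gauge: the least \<open>t\<close> for which \<open>t s\<close> dominates
  \<open>y\<close> in the order of \<open>M\<close>. The condition \<open>0 <= t\<close> bounds the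
  set below and makes the gauge vanish on \<open>- M\<close>, which later forces the multiplier into
  the dual cone.\<close>

definition order_gauge :: "real Matrix.vec set \<Rightarrow> real Matrix.vec \<Rightarrow> real Matrix.vec \<Rightarrow> real" where
  "order_gauge M s y = Inf {t. 0 \<le> t \<and> t \<cdot>\<^sub>v s - y \<in> M}"

lemma order_gauge_le:
  assumes "0 \<le> t" "t \<cdot>\<^sub>v s - y \<in> M"
  shows "order_gauge M s y \<le> t"
  unfolding order_gauge_def using assms by (intro cInf_lower) (auto intro: bdd_belowI[of _ 0])

text \<open>The order unit property makes the set under \<open>Inf\<close> nonempty, so that the
  real infimum is meaningful.\<close>

lemma order_gauge_greatest:
  assumes M: "regular_cone m M" and s: "s \<in> vec_topology m interior_of M"
    and y: "y \<in> carrier_vec m"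
    and le: "\<And>t. \<lbrakk>0 \<le> t; t \<cdot>\<^sub>v s - y \<in> M\<rbrakk> \<Longrightarrow> b \<le> t"
  shows "b \<le> order_gauge M s y"
proof -
  have sc: "s \<in> carrier_vec m"
    using s interior_of_subset[of "vec_topology m" M] regular_cone_carrier[OF M] by blast
  obtain t where "0 \<le> t" "t \<cdot>\<^sub>v s + - y \<in> M"
    using interior_cone_order_unit[OF M s, of "- y"] y by auto
  moreover have "t \<cdot>\<^sub>v s + - y = t \<cdot>\<^sub>v s - y" using sc y by (intro eq_vecI) auto
  ultimately show ?thesis
    unfolding order_gauge_def using le by (intro cInf_greatest) auto
qed

lemma sublinear_on_order_gauge:
  assumes M: "regular_cone m M" and s: "s \<in> vec_topology m interior_of M"
  shows "sublinear_on m (order_gauge M s)"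
  unfolding sublinear_on_def
proof safe
  note greatest = order_gauge_greatest[OF M s]
  have sc: "s \<in> carrier_vec m"
    using s interior_of_subset[of "vec_topology m" M] regular_cone_carrier[OF M] by blast
  {
    fix x y :: "real Matrix.vec" assume x: "x \<in> carrier_vec m" and y: "y \<in> carrier_vec m"
    have *: "order_gauge M s (x + y) \<le> t + u"
      if "0 \<le> t" "t \<cdot>\<^sub>v s - x \<in> M" "0 \<le> u" "u \<cdot>\<^sub>v s - y \<in> M" for t u
    proof (rule order_gauge_le)
      have "(t \<cdot>\<^sub>v s - x) + (u \<cdot>\<^sub>v s - y) = (t + u) \<cdot>\<^sub>v s - (x + y)"
        using sc x y by (intro eq_vecI) (auto simp: algebra_simps)
      then show "(t + u) \<cdot>\<^sub>v s - (x + y) \<in> M"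
        using regular_cone_add[OF M that(2,4)] by simp
    qed (use that in simp)
    have "order_gauge M s (x + y) - u \<le> order_gauge M s x"
      if "0 \<le> u" "u \<cdot>\<^sub>v s - y \<in> M" for u
      using *[OF _ _ that] by (intro greatest[OF x]) (simp add: algebra_simps)
    then have "order_gauge M s (x + y) - order_gauge M s x \<le> order_gauge M s y"
      by (intro greatest[OF y]) (simp add: algebra_simps)
    then show "order_gauge M s (x + y) \<le> order_gauge M s x + order_gauge M s y" by simp
  }
  fix x :: "real Matrix.vec" and c :: real assume x: "x \<in> carrier_vec m" and c: "0 \<le> c"
  show "order_gauge M s (c \<cdot>\<^sub>v x) \<le> c * order_gauge M s x"
  proof (cases "c = 0")
    case True
    have "0 \<cdot>\<^sub>v s - c \<cdot>\<^sub>v x = 0\<^sub>v m" using True sc x by (intro eq_vecI) auto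
    then show ?thesis using True regular_cone_zero[OF M] order_gauge_le[of 0 s "c \<cdot>\<^sub>v x" M] by simp
  next
    case False
    with c have c: "0 < c" by simp
    have "order_gauge M s (c \<cdot>\<^sub>v x) / c \<le> t" if t: "0 \<le> t" "t \<cdot>\<^sub>v s - x \<in> M" for t
    proof -
      have "c \<cdot>\<^sub>v (t \<cdot>\<^sub>v s - x) = (c * t) \<cdot>\<^sub>v s - c \<cdot>\<^sub>v x"
        using sc x by (intro eq_vecI) (auto simp: algebra_simps)
      then have "order_gauge M s (c \<cdot>\<^sub>v x) \<le> c * t"
        using t c regular_cone_smult[OF M t(2), of c] by (intro order_gauge_le) auto
      then show ?thesis using c by (simp add: field_simps)
    qed
    from greatest[OF x this] show ?thesis using c by (simp add: field_simps)
  qed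
qed

lemma sublinear_on_cmult:
  assumes "sublinear_on n p" "0 \<le> c"
  shows "sublinear_on n (\<lambda>x. c * p x)"
  unfolding sublinear_on_def
proof safe
  fix x y :: "real Matrix.vec" assume "x \<in> carrier_vec n" "y \<in> carrier_vec n"
  then show "c * p (x + y) \<le> c * p x + c * p y"
    using assms by (metis distrib_left mult_left_mono sublinear_on_add)
next
  fix x :: "real Matrix.vec" and b :: real assume "x \<in> carrier_vec n" "0 \<le> b"
  then show "c * p (b \<cdot>\<^sub>v x) \<le> b * (c * p x)"
    using sublinear_on_smult_eq[OF assms(1)] by simp
qed

section \<open>Duality for essentially strictly feasible conic programs\<close>

lemma conic_le_cone_prod_append:
  assumes "a \<in> carrier_vec k" "a' \<in> carrier_vec k" "b \<in> carrier_vec l" "b' \<in> carrier_vec l"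
    and "K \<subseteq> carrier_vec k"
  shows "conic_le (cone_prod K M) (a @\<^sub>v b) (a' @\<^sub>v b') \<longleftrightarrow> conic_le K a a' \<and> conic_le M b b'"
proof -
  have *: "(a' @\<^sub>v b') - (a @\<^sub>v b) = (a' - a) @\<^sub>v (b' - b)"
    using assms by (intro eq_vecI) auto
  have "(a' - a) @\<^sub>v (b' - b) \<in> cone_prod K M \<longleftrightarrow> a' - a \<in> K \<and> b' - b \<in> M"
  proof
    assume "(a' - a) @\<^sub>v (b' - b) \<in> cone_prod K M"
    then obtain x y where xy: "(a' - a) @\<^sub>v (b' - b) = x @\<^sub>v y" "x \<in> K" "y \<in> M"
      by (auto simp: cone_prod_def)
    have "a' - a = x \<and> b' - b = y"
      using append_vec_eq[of "a' - a" k x "b' - b" y] assms xy by auto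
    then show "a' - a \<in> K \<and> b' - b \<in> M" using xy by simp
  qed (auto simp: cone_prod_def)
  with * show ?thesis by (simp add: conic_le_def)
qed

lemma conic_le_nonneg_orthant:
  assumes "a \<in> carrier_vec k" "b \<in> carrier_vec k"
  shows "conic_le (nonneg_orthant k) a b \<longleftrightarrow> a \<le> b"
  using assms by (auto simp: conic_le_def nonneg_orthant_def less_eq_vec_def)

lemma mult_mat_vec_comb:
  fixes A :: "real mat"
  assumes "A \<in> carrier_mat m n" "x \<in> carrier_vec n" "y \<in> carrier_vec n"
  shows "A *\<^sub>v (a \<cdot>\<^sub>v x + b \<cdot>\<^sub>v y) = a \<cdot>\<^sub>v (A *\<^sub>v x) + b \<cdot>\<^sub>v (A *\<^sub>v y)"
  using assms by (simp add: mult_add_distrib_mat_vec[of _ m n] mult_mat_vec[of _ m n])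

lemma mult_mat_vec_le_comb:
  fixes P :: "real mat"
  assumes P: "P \<in> carrier_mat k n" and x: "x \<in> carrier_vec n" "x' \<in> carrier_vec n"
    and le: "P *\<^sub>v x \<le> p" "P *\<^sub>v x' \<le> p" and ab: "0 \<le> a" "0 \<le> b" "a + b = 1"
  shows "P *\<^sub>v (a \<cdot>\<^sub>v x + b \<cdot>\<^sub>v x') \<le> p"
proof -
  have "a * (P *\<^sub>v x) $ i + b * (P *\<^sub>v x') $ i \<le> p $ i" if "i < dim_vec p" for i
    using le ab that unfolding less_eq_vec_def by (intro convex_bound_le) auto
  moreover have "dim_vec p = k" using le(1) P by (simp add: less_eq_vec_def)
  ultimately show ?thesis
    using P unfolding mult_mat_vec_comb[OF P x] less_eq_vec_def
    by (simp del: index_mult_mat_vec)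
qed

text \<open>Strong duality with an attained multiplier, in two stages. The penalised problem on the
  polyhedron \<open>P x <= p\<close> yields \<open>\<mu>\<close>; the Lagrangian
  \<open>h x - \<mu> (Q x - q)\<close> is then bounded by \<open>c\<close> on that polyhedron, and
  Farkas converts this bound into \<open>lam\<close>. With \<open>c\<close> an arbitrary upper
  bound, attainment in the primal problem never comes up.\<close>

lemma ess_strictly_feasible_duality:
  assumes ess: "ess_strictly_feasible m K n A a" and h: "h \<in> carrier_vec n"
    and bound: "\<And>x. \<lbrakk>x \<in> carrier_vec n; conic_le K (A *\<^sub>v x) a\<rbrakk> \<Longrightarrow> h \<bullet> x \<le> c"
  obtains \<xi> where "\<xi> \<in> dual_cone m K" "transpose_mat A *\<^sub>v \<xi> = h" "a \<bullet> \<xi> \<le> c"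
proof -
  from ess obtain k l M P Q p q x0 where m: "m = k + l" and M: "regular_cone l M"
    and K: "K = cone_prod (nonneg_orthant k) M"
    and P: "P \<in> carrier_mat k n" and Q: "Q \<in> carrier_mat l n" and A: "A = P @\<^sub>r Q"
    and p: "p \<in> carrier_vec k" and q: "q \<in> carrier_vec l" and a: "a = p @\<^sub>v q"
    and x0: "x0 \<in> carrier_vec n" "P *\<^sub>v x0 \<le> p"
      "q - Q *\<^sub>v x0 \<in> vec_topology l interior_of M"
    unfolding ess_strictly_feasible_def by blast
  define s where "s = q - Q *\<^sub>v x0"
  have sc: "s \<in> carrier_vec l" using q Q x0 by (simp add: s_def)
  have s: "s \<in> vec_topology l interior_of M" using x0 by (simp add: s_def)
  have sM: "s \<in> M" using s interior_of_subset[of "vec_topology l" M] by blast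
  have orth: "nonneg_orthant k \<subseteq> carrier_vec k" by (auto simp: nonneg_orthant_def)
  have feas: "conic_le K (A *\<^sub>v x) a \<longleftrightarrow> P *\<^sub>v x \<le> p \<and> q - Q *\<^sub>v x \<in> M"
    if x: "x \<in> carrier_vec n" for x
    unfolding K A a mat_mult_append[OF P Q x]
    using conic_le_cone_prod_append[OF _ _ _ _ orth, of "P *\<^sub>v x" p "Q *\<^sub>v x" l q M]
      conic_le_nonneg_orthant[of "P *\<^sub>v x" k p] P Q p q x
    by (auto simp: conic_le_def)
  \<comment> \<open>The slack of the bound at \<open>x0\<close>, which will be the price of one unit
    of gauge. It is nonnegative since \<open>x0\<close> is feasible, and it may be
    \<open>0\<close>.\<close>
  define N where "N = c - h \<bullet> x0"
  have N: "0 \<le> N" using bound[of x0] feas x0 sM by (simp add: N_def s_def)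
  \<comment> \<open>Moving from \<open>x\<close> towards the strictly feasible \<open>x0\<close> restores feasibility, so that
     \<open>N\<close> times the gauge is an exact penalty for the constraint \<open>Q x \<le>\<^sub>M q\<close>.\<close>
  have penalty: "h \<bullet> x - c \<le> N * t"
    if x: "x \<in> carrier_vec n" "P *\<^sub>v x \<le> p" and t: "0 \<le> t" "t \<cdot>\<^sub>v s - (Q *\<^sub>v x - q) \<in> M" for x t
  proof -
    \<comment> \<open>With this \<open>b\<close> the numbers \<open>b\<close> and
      \<open>b * t\<close> are convex weights in the ratio \<open>1 : t\<close>, so a violation at
      \<open>x\<close> of at most \<open>t s\<close> is absorbed by the slack \<open>s\<close> at
      \<open>x0\<close>.\<close>
    define b where "b = 1 / (1 + t)"
    have b: "0 \<le> b" "0 \<le> b * t" "b + b * t = 1"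
      using t(1) by (auto simp: b_def field_simps)
    define y where "y = b \<cdot>\<^sub>v x + (b * t) \<cdot>\<^sub>v x0"
    have y: "y \<in> carrier_vec n" using x x0 by (simp add: y_def)
    have Qy: "Q *\<^sub>v y = b \<cdot>\<^sub>v (Q *\<^sub>v x) + (b * t) \<cdot>\<^sub>v (Q *\<^sub>v x0)"
      using Q x x0 by (simp add: y_def mult_mat_vec_comb[of _ l n])
    have "P *\<^sub>v y \<le> p"
      unfolding y_def using P x x0 b by (intro mult_mat_vec_le_comb) auto
    moreover have "q - Q *\<^sub>v y = b \<cdot>\<^sub>v (t \<cdot>\<^sub>v s - (Q *\<^sub>v x - q))"
    proof (rule eq_vecI)
      fix i assume "i < dim_vec (b \<cdot>\<^sub>v (t \<cdot>\<^sub>v s - (Q *\<^sub>v x - q)))"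
      then have i: "i < l" using q by simp
      have "(q - Q *\<^sub>v y) $ i = (b + b * t) * q $ i - (b * (Q *\<^sub>v x) $ i + (b * t) * (Q *\<^sub>v x0) $ i)"
        unfolding Qy b(3) using Q q i by (simp del: index_mult_mat_vec)
      also have "\<dots> = (b \<cdot>\<^sub>v (t \<cdot>\<^sub>v s - (Q *\<^sub>v x - q))) $ i"
        using Q q i by (simp add: s_def algebra_simps del: index_mult_mat_vec)
      finally show "(q - Q *\<^sub>v y) $ i = (b \<cdot>\<^sub>v (t \<cdot>\<^sub>v s - (Q *\<^sub>v x - q))) $ i" .
    qed (use Q q in auto)
    then have "q - Q *\<^sub>v y \<in> M" using regular_cone_smult[OF M t(2) b(1)] by simp
    ultimately have "h \<bullet> y \<le> c" using bound[OF y] feas[OF y] by simp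
    moreover have "h \<bullet> y = b * (h \<bullet> x) + (b * t) * (h \<bullet> x0)"
      using h x x0 by (simp add: y_def scalar_prod_add_distrib[of _ n])
    ultimately have "b * (h \<bullet> x + t * (h \<bullet> x0)) \<le> c" by (simp add: algebra_simps)
    then have "h \<bullet> x + t * (h \<bullet> x0) \<le> c * (1 + t)"
      using t(1) by (simp add: b_def field_simps)
    then show ?thesis by (simp add: N_def algebra_simps)
  qed
  let ?g = "order_gauge M s"
  \<comment> \<open>Violation of the \<open>M\<close> constraint paired with the slack of the
    objective bound.\<close>
  define D where "D = {(Q *\<^sub>v x - q, c - h \<bullet> x) | x. x \<in> carrier_vec n \<and> P *\<^sub>v x \<le> p}"
  obtain \<mu> where \<mu>: "\<mu> \<in> carrier_vec l" "\<And>y. y \<in> carrier_vec l \<Longrightarrow> \<mu> \<bullet> y \<le> N * ?g y"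
    "\<And>d a. (d, a) \<in> D \<Longrightarrow> - (\<mu> \<bullet> d) \<le> a"
  proof (rule Hahn_Banach_sandwich[OF sublinear_on_cmult[OF sublinear_on_order_gauge[OF M s] N], of D])
    show "D \<subseteq> carrier_vec l \<times> UNIV" using Q q by (auto simp: D_def)
    show "(b \<cdot>\<^sub>v d + t \<cdot>\<^sub>v d', b * e + t * e') \<in> D"
      if D: "(d, e) \<in> D" "(d', e') \<in> D" and bt: "0 \<le> b" "0 \<le> t" "b + t = 1" for d e d' e' b t
    proof -
      obtain x where x: "d = Q *\<^sub>v x - q" "e = c - h \<bullet> x" "x \<in> carrier_vec n" "P *\<^sub>v x \<le> p"
        using D(1) by (auto simp: D_def)
      obtain x' where x': "d' = Q *\<^sub>v x' - q" "e' = c - h \<bullet> x'" "x' \<in> carrier_vec n" "P *\<^sub>v x' \<le> p"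
        using D(2) by (auto simp: D_def)
      define y where "y = b \<cdot>\<^sub>v x + t \<cdot>\<^sub>v x'"
      have y: "y \<in> carrier_vec n" using x x' by (simp add: y_def)
      have Qy: "Q *\<^sub>v y = b \<cdot>\<^sub>v (Q *\<^sub>v x) + t \<cdot>\<^sub>v (Q *\<^sub>v x')"
        using Q x x' by (simp add: y_def mult_mat_vec_comb[of _ l n])
      have "P *\<^sub>v y \<le> p"
        unfolding y_def using P x x' bt by (intro mult_mat_vec_le_comb) auto
      moreover have "b \<cdot>\<^sub>v d + t \<cdot>\<^sub>v d' = Q *\<^sub>v y - q"
      proof (rule eq_vecI)
        fix i assume "i < dim_vec (Q *\<^sub>v y - q)"
        then have i: "i < l" using q by simp
        have "(b \<cdot>\<^sub>v d + t \<cdot>\<^sub>v d') $ i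
            = b * (Q *\<^sub>v x) $ i + t * (Q *\<^sub>v x') $ i - (b + t) * q $ i"
          using Q q i x(1) x'(1) by (simp add: algebra_simps del: index_mult_mat_vec)
        also have "\<dots> = (Q *\<^sub>v y - q) $ i"
          unfolding Qy bt(3) using Q q i by (simp del: index_mult_mat_vec)
        finally show "(b \<cdot>\<^sub>v d + t \<cdot>\<^sub>v d') $ i = (Q *\<^sub>v y - q) $ i" .
      qed (use Q q x x' in auto)
      moreover have "b * e + t * e' = c - h \<bullet> y"
      proof -
        have "h \<bullet> y = b * (h \<bullet> x) + t * (h \<bullet> x')"
          using h x x' by (simp add: y_def scalar_prod_add_distrib[of _ n])
        moreover have "b * c + t * c = c" using bt(3) by (simp add: distrib_right[symmetric])
        moreover have "b * e + t * e' = (b * c + t * c) - (b * (h \<bullet> x) + t * (h \<bullet> x'))"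
          unfolding x(2) x'(2) by (simp add: algebra_simps)
        ultimately show ?thesis by simp
      qed
      ultimately show ?thesis using y by (auto simp: D_def)
    qed
    show "0 \<le> N * ?g d + e" if de: "(d, e) \<in> D" for d e
    proof -
      obtain x where x: "d = Q *\<^sub>v x - q" "e = c - h \<bullet> x" "x \<in> carrier_vec n" "P *\<^sub>v x \<le> p"
        using de by (auto simp: D_def)
      have d: "d \<in> carrier_vec l" using x Q q by simp
      show ?thesis
      \<comment> \<open>For \<open>N > 0\<close> the penalty inequality is divided by
        \<open>N\<close> and compared with the infimum defining the gauge. For \<open>N = 0\<close>
        one admissible \<open>t\<close> already shows that the objective does not exceed
        \<open>c\<close>.\<close>
      proof (cases "N = 0")
        case False
        with N have N0: "0 < N" by simp
        have "(h \<bullet> x - c) / N \<le> ?g d"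
          using penalty[OF x(3,4)] N0 x(1)
          by (intro order_gauge_greatest[OF M s d]) (auto simp: field_simps)
        then show ?thesis using N0 x(2) by (simp add: field_simps)
      next
        case True
        obtain t where t: "0 \<le> t" "t \<cdot>\<^sub>v s + - d \<in> M"
          using interior_cone_order_unit[OF M s, of "- d"] d by auto
        have "t \<cdot>\<^sub>v s + - d = t \<cdot>\<^sub>v s - d" using sc d by (intro eq_vecI) auto
        then have "h \<bullet> x - c \<le> 0" using penalty[OF x(3,4) t(1)] t(2) x(1) True by simp
        then show ?thesis using True x(2) by simp
      qed
    qed
  qed blast
  \<comment> \<open>On \<open>- M\<close> the gauge is at most \<open>0\<close>, and so is the
    functional that its multiple dominates.\<close>
  have \<mu>_dual: "0 \<le> \<mu> \<bullet> y" if y: "y \<in> M" for y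
  proof -
    have yc: "y \<in> carrier_vec l" using y regular_cone_carrier[OF M] by blast
    have "0 \<cdot>\<^sub>v s - (- y) = y" using sc yc by (intro eq_vecI) auto
    then have "?g (- y) \<le> 0" using y by (intro order_gauge_le) auto
    then have "N * ?g (- y) \<le> 0" using N by (simp add: mult_nonneg_nonpos)
    then have "\<mu> \<bullet> (- y) \<le> 0" using \<mu>(2)[of "- y"] yc by simp
    then show ?thesis using \<mu>(1) yc by simp
  qed
  \<comment> \<open>The objective of the remaining linear program, after the \<open>M\<close>
    constraint has moved into the Lagrangian.\<close>
  let ?h = "h - transpose_mat Q *\<^sub>v \<mu>"
  have hc: "?h \<in> carrier_vec n" using h Q \<mu> by simp
  have h_prod: "?h \<bullet> x = h \<bullet> x - \<mu> \<bullet> (Q *\<^sub>v x)" if "x \<in> carrier_vec n" for x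
    using that h Q \<mu>(1) transpose_mult_scalar_prod[OF Q \<mu>(1) that]
    by (simp add: minus_scalar_prod_distrib[of _ n])
  have "?h \<bullet> x \<le> c - \<mu> \<bullet> q" if x: "x \<in> carrier_vec n" "P *\<^sub>v x \<le> p" for x
  proof -
    have "(Q *\<^sub>v x - q, c - h \<bullet> x) \<in> D" using x by (auto simp: D_def)
    from \<mu>(3)[OF this] have "h \<bullet> x - c \<le> \<mu> \<bullet> (Q *\<^sub>v x - q)" by simp
    also have "\<dots> = \<mu> \<bullet> (Q *\<^sub>v x) - \<mu> \<bullet> q"
      using \<mu>(1) Q q x by (simp add: scalar_prod_minus_distrib[of _ l])
    finally show ?thesis using h_prod[OF x(1)] by simp
  qed
  then obtain lam where lam: "lam \<in> nonneg_orthant k" "transpose_mat P *\<^sub>v lam = ?h"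
    "lam \<bullet> p \<le> c - \<mu> \<bullet> q"
    using Farkas_affine[OF P p hc x0(1,2)] by blast
  have lam_c: "lam \<in> carrier_vec k" using lam orth by blast
  have Ac: "A \<in> carrier_mat m n" using P Q by (simp add: A m)
  show thesis
  proof (rule that[of "lam @\<^sub>v \<mu>"])
    show "lam @\<^sub>v \<mu> \<in> dual_cone m K"
      unfolding dual_cone_def
    proof safe
      show "lam @\<^sub>v \<mu> \<in> carrier_vec m" using lam_c \<mu>(1) m by simp
      fix z assume "z \<in> K"
      then obtain x y where xy: "z = x @\<^sub>v y" "x \<in> nonneg_orthant k" "y \<in> M"
        by (auto simp: K cone_prod_def)
      have c: "x \<in> carrier_vec k" "y \<in> carrier_vec l"
        using xy orth regular_cone_carrier[OF M] by blast+
      have "0 \<le> lam \<bullet> x"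
        using lam(1) xy(2) by (auto simp: scalar_prod_def nonneg_orthant_def intro!: sum_nonneg)
      then show "0 \<le> (lam @\<^sub>v \<mu>) \<bullet> z"
        using \<mu>_dual[OF xy(3)] scalar_prod_append[OF lam_c \<mu>(1) c] xy(1) by simp
    qed
    show "transpose_mat A *\<^sub>v (lam @\<^sub>v \<mu>) = h"
    proof (rule vec_eqI_scalar_prod)
      fix x :: "real Matrix.vec" assume x: "x \<in> carrier_vec n"
      have "(transpose_mat A *\<^sub>v (lam @\<^sub>v \<mu>)) \<bullet> x = (lam @\<^sub>v \<mu>) \<bullet> (A *\<^sub>v x)"
        using lam_c \<mu>(1) m x by (intro transpose_mult_scalar_prod[OF Ac]) auto
      also have "\<dots> = lam \<bullet> (P *\<^sub>v x) + \<mu> \<bullet> (Q *\<^sub>v x)"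
        unfolding A mat_mult_append[OF P Q x]
        using P Q x by (intro scalar_prod_append[OF lam_c \<mu>(1)]) auto
      also have "lam \<bullet> (P *\<^sub>v x) = ?h \<bullet> x"
        using transpose_mult_scalar_prod[OF P lam_c x] lam(2) by simp
      also have "?h \<bullet> x + \<mu> \<bullet> (Q *\<^sub>v x) = h \<bullet> x" using h_prod[OF x] by simp
      finally show "(transpose_mat A *\<^sub>v (lam @\<^sub>v \<mu>)) \<bullet> x = h \<bullet> x" .
    qed (use Ac lam_c \<mu>(1) m h in auto)
    have "a \<bullet> (lam @\<^sub>v \<mu>) = p \<bullet> lam + q \<bullet> \<mu>"
      unfolding a by (rule scalar_prod_append[OF p q lam_c \<mu>(1)])
    also have "\<dots> = lam \<bullet> p + \<mu> \<bullet> q"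
      using comm_scalar_prod[OF p lam_c] comm_scalar_prod[OF q \<mu>(1)] by simp
    finally show "a \<bullet> (lam @\<^sub>v \<mu>) \<le> c" using lam(3) by simp
  qed
qed

subsection \<open>Minimax\<close>

lemma compactin_attains_sup:
  assumes "compactin T S" "S \<noteq> {}" "continuous_map (subtopology T S) euclideanreal f"
  obtains x where "x \<in> S" "\<And>y. y \<in> S \<Longrightarrow> f y \<le> f x"
proof -
  have "compactin euclideanreal (f ` S)"
    using assms(1,3) by (intro image_compactin[of "subtopology T S"]) (auto simp: compactin_subtopology)
  then show thesis
    using compact_attains_sup[of "f ` S"] assms(2) that by auto
qed

text \<open>The slice is the image, under dropping the first \<open>n\<close> coordinates, of the
  part of \<open>Y\<close> where these coordinates equal \<open>w\<close>. That part is closed in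
  \<open>Y\<close> as the zero set of the continuous \<open>l1\<close> distance to
  \<open>w\<close>.\<close>

lemma compactin_vec_slice:
  assumes Y: "compactin (vec_topology (n + m)) Y" and w: "w \<in> carrier_vec n"
  shows "compactin (vec_topology m) {z \<in> carrier_vec m. w @\<^sub>v z \<in> Y}"
proof -
  let ?g = "\<lambda>y. \<Sum>i<n. \<bar>y $ i - w $ i\<bar>"
  let ?C = "{y \<in> topspace (vec_topology (n + m)). ?g y \<in> {0}}"
  let ?tl = "\<lambda>y. Matrix.vec m (\<lambda>i. y $ (n + i))"
  have "continuous_map (vec_topology (n + m)) euclideanreal ?g"
    by (intro continuous_map_sum continuous_map_real_abs continuous_map_diff continuous_map_vec_index) auto
  then have "closedin (vec_topology (n + m)) ?C"
    by (rule closedin_continuous_map_preimage) auto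
  then have "compactin (vec_topology (n + m)) (?C \<inter> Y)"
    using Y by (rule closed_Int_compactin)
  moreover have "continuous_map (vec_topology (n + m)) (vec_topology m) ?tl"
    by (intro continuous_map_into_vec_topology) (auto intro: continuous_map_vec_index)
  ultimately have "compactin (vec_topology m) (?tl ` (?C \<inter> Y))"
    by (rule image_compactin)
  also have "?tl ` (?C \<inter> Y) = {z \<in> carrier_vec m. w @\<^sub>v z \<in> Y}"
  proof safe
    fix y assume y: "y \<in> Y" "y \<in> topspace (vec_topology (n + m))" "?g y = 0"
    then have "\<forall>i<n. y $ i = w $ i" by (simp add: sum_nonneg_eq_0_iff)
    then have "w @\<^sub>v ?tl y = y" using y(2) w by (intro eq_vecI) auto
    then show "w @\<^sub>v ?tl y \<in> Y" using y(1) by simp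
  next
    fix z assume z: "z \<in> carrier_vec m" "w @\<^sub>v z \<in> Y"
    have "?tl (w @\<^sub>v z) = z" using z(1) w by (intro eq_vecI) auto
    moreover have "w @\<^sub>v z \<in> ?C \<inter> Y" using z w by simp
    ultimately show "z \<in> ?tl ` (?C \<inter> Y)" 
      by (intro rev_image_eqI[of "w @\<^sub>v z"]) auto
  qed auto
  finally show ?thesis .
qed

lemma sublinear_on_l1:
  "sublinear_on n (\<lambda>y. \<Sum>i<n. \<bar>y $ i\<bar>)"
  unfolding sublinear_on_def
proof safe
  fix x y :: "real Matrix.vec" assume "x \<in> carrier_vec n" "y \<in> carrier_vec n"
  then show "(\<Sum>i<n. \<bar>(x + y) $ i\<bar>) \<le> (\<Sum>i<n. \<bar>x $ i\<bar>) + (\<Sum>i<n. \<bar>y $ i\<bar>)"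
    by (simp add: sum.distrib[symmetric] sum_mono abs_triangle_ineq)
next
  fix x :: "real Matrix.vec" and c :: real assume "x \<in> carrier_vec n" "0 \<le> c"
  then show "(\<Sum>i<n. \<bar>(c \<cdot>\<^sub>v x) $ i\<bar>) \<le> c * (\<Sum>i<n. \<bar>x $ i\<bar>)"
    by (simp add: abs_mult sum_distrib_left)
qed

text \<open>Compactness provides a nearest point \<open>y0\<close>, so the \<open>l1\<close>
  distance \<delta> from \<open>z\<close> to \<open>S\<close> is positive. The sandwich for the
  pairs \<open>(y - z, - \<delta>)\<close> gives \<open>a\<close> with \<open>a (y - z)\<close> at
  least \<delta> on all of \<open>S\<close>, so \<open>- a\<close> separates with gap
  \<delta>.\<close>

lemma compact_convex_separation:
  assumes S: "compactin (vec_topology n) S" "vec_convex S" "S \<noteq> {}"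
    and z: "z \<in> carrier_vec n" "z \<notin> S"
  obtains h c where "h \<in> carrier_vec n" "\<And>y. y \<in> S \<Longrightarrow> h \<bullet> y \<le> c" "c < h \<bullet> z"
proof -
  have Sc: "S \<subseteq> carrier_vec n" using compactin_subset_topspace[OF S(1)] by simp
  let ?f = "\<lambda>y. \<Sum>i<n. \<bar>y $ i - z $ i\<bar>"
  have "continuous_map (vec_topology n) euclideanreal (\<lambda>y. - ?f y)"
    by (intro continuous_map_sum continuous_map_real_abs continuous_map_diff continuous_map_minus
        continuous_map_vec_index) auto
  then obtain y0 where y0: "y0 \<in> S" "\<And>y. y \<in> S \<Longrightarrow> - ?f y \<le> - ?f y0"
    using compactin_attains_sup[OF S(1,3) continuous_map_from_subtopology] by blast
  have "?f y0 \<noteq> 0"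
  proof
    assume "?f y0 = 0"
    then have "\<forall>i<n. y0 $ i = z $ i" by (simp add: sum_nonneg_eq_0_iff)
    then have "y0 = z" using y0(1) Sc z(1) by (intro eq_vecI) auto
    then show False using y0(1) z(2) by simp
  qed
  moreover have "0 \<le> ?f y0" by (intro sum_nonneg) auto
  ultimately have pos: "0 < ?f y0" by linarith
  let ?D = "{(y - z, - ?f y0) | y. y \<in> S}"
  obtain a where a: "a \<in> carrier_vec n" "\<And>d e. (d, e) \<in> ?D \<Longrightarrow> - (a \<bullet> d) \<le> e"
  proof (rule Hahn_Banach_sandwich[OF sublinear_on_l1, of ?D n])
    show "?D \<subseteq> carrier_vec n \<times> UNIV" using Sc z by auto
    show "(s \<cdot>\<^sub>v d + t \<cdot>\<^sub>v d', s * e + t * e') \<in> ?D"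
      if D: "(d, e) \<in> ?D" "(d', e') \<in> ?D" and st: "0 \<le> s" "0 \<le> t" "s + t = 1" for d e d' e' s t
    proof -
      obtain y y' where y: "y \<in> S" "y' \<in> S" "d = y - z" "d' = y' - z" "e = - ?f y0" "e' = - ?f y0"
        using D by auto
      have c: "y \<in> carrier_vec n" "y' \<in> carrier_vec n" using y Sc by auto
      have "s \<cdot>\<^sub>v y + t \<cdot>\<^sub>v y' \<in> S" using S(2) y st by (auto simp: vec_convex_def)
      moreover have "s \<cdot>\<^sub>v d + t \<cdot>\<^sub>v d' = (s \<cdot>\<^sub>v y + t \<cdot>\<^sub>v y') - z"
      proof (rule eq_vecI)
        fix i assume "i < dim_vec ((s \<cdot>\<^sub>v y + t \<cdot>\<^sub>v y') - z)"
        then have i: "i < n" using z by simp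
        have "(s \<cdot>\<^sub>v d + t \<cdot>\<^sub>v d') $ i = s * y $ i + t * y' $ i - (s + t) * z $ i"
          using y c z i by (simp add: algebra_simps)
        also have "\<dots> = ((s \<cdot>\<^sub>v y + t \<cdot>\<^sub>v y') - z) $ i"
          unfolding st(3) using c z i by simp
        finally show "(s \<cdot>\<^sub>v d + t \<cdot>\<^sub>v d') $ i = ((s \<cdot>\<^sub>v y + t \<cdot>\<^sub>v y') - z) $ i" .
      qed (use y c z in auto)
      moreover have "s * e + t * e' = - ?f y0"
        unfolding y(5,6) distrib_right[symmetric] st(3) by simp
      ultimately show ?thesis by blast
    qed
    show "0 \<le> (\<Sum>i<n. \<bar>d $ i\<bar>) + e" if "(d, e) \<in> ?D" for d e
      using that y0(2) z Sc by auto
  qed blast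
  show thesis
  proof (rule that[of "- a" "- (a \<bullet> z) - ?f y0"])
    show "- a \<bullet> y \<le> - (a \<bullet> z) - ?f y0" if y: "y \<in> S" for y
    proof -
      have "- (a \<bullet> (y - z)) \<le> - ?f y0" by (rule a(2)) (use y in blast)
      moreover have "a \<bullet> (y - z) = a \<bullet> y - a \<bullet> z"
        using a(1) y z Sc by (intro scalar_prod_minus_distrib[of _ n]) auto
      moreover have "- a \<bullet> y = - (a \<bullet> y)" using a(1) y Sc by auto
      ultimately show ?thesis by simp
    qed
    show "- (a \<bullet> z) - ?f y0 < - a \<bullet> z" using pos a(1) z by simp
  qed (use a in simp)
qed

text \<open>A pair \<open>(h, a)\<close> in \<open>F\<close> stands for the affine function
  \<open>h z + a\<close> of \<open>z\<close>. A linear functional on slopes lying below the support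
  function of \<open>S\<close> is a point of \<open>S\<close>, and the sandwich finds one that also
  respects \<open>V\<close>. The hypothesis \<open>bound\<close> speaks of upper bounds
  \<open>b\<close> instead of a supremum, as the duality lemma does.\<close>

lemma minimax_affine:
  fixes F :: "(real Matrix.vec \<times> real) set"
  assumes S: "compactin (vec_topology n) S" "vec_convex S" "S \<noteq> {}"
    and F: "F \<subseteq> carrier_vec n \<times> UNIV"
    and conv: "\<And>h a h' a' s t. \<lbrakk>(h, a) \<in> F; (h', a') \<in> F; 0 \<le> s; 0 \<le> t; s + t = 1\<rbrakk>
      \<Longrightarrow> (s \<cdot>\<^sub>v h + t \<cdot>\<^sub>v h', s * a + t * a') \<in> F"
    and bound: "\<And>h a b. \<lbrakk>(h, a) \<in> F; \<And>z. z \<in> S \<Longrightarrow> h \<bullet> z \<le> b\<rbrakk> \<Longrightarrow> V \<le> b + a"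
  obtains z where "z \<in> S" "\<And>h a. (h, a) \<in> F \<Longrightarrow> V \<le> h \<bullet> z + a"
proof -
  have Sc: "S \<subseteq> carrier_vec n" using compactin_subset_topspace[OF S(1)] by simp
  define \<sigma> where "\<sigma> h = (SUP z\<in>S. h \<bullet> z)" for h :: "real Matrix.vec"
  have \<sigma>_le: "\<sigma> h \<le> b" if "\<And>z. z \<in> S \<Longrightarrow> h \<bullet> z \<le> b" for h b
    unfolding \<sigma>_def using S(3) that by (rule cSUP_least)
  have le_\<sigma>: "h \<bullet> z \<le> \<sigma> h" if h: "h \<in> carrier_vec n" and z: "z \<in> S" for h z
  proof -
    obtain x where "x \<in> S" "\<And>y. y \<in> S \<Longrightarrow> h \<bullet> y \<le> h \<bullet> x"
      using compactin_attains_sup[OF S(1,3)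
          continuous_map_from_subtopology[OF continuous_map_scalar_prod[OF h]]] by blast
    then show ?thesis unfolding \<sigma>_def using z by (intro cSUP_upper bdd_aboveI2)
  qed
  have sub: "sublinear_on n \<sigma>"
    unfolding sublinear_on_def
  proof safe
    fix x y :: "real Matrix.vec" assume x: "x \<in> carrier_vec n" and y: "y \<in> carrier_vec n"
    show "\<sigma> (x + y) \<le> \<sigma> x + \<sigma> y"
    proof (rule \<sigma>_le)
      fix z assume z: "z \<in> S"
      then have "(x + y) \<bullet> z = x \<bullet> z + y \<bullet> z"
        using x y Sc by (intro add_scalar_prod_distrib[of _ n]) auto
      then show "(x + y) \<bullet> z \<le> \<sigma> x + \<sigma> y" using le_\<sigma>[OF x z] le_\<sigma>[OF y z] by simp
    qed
  next
    fix x :: "real Matrix.vec" and c :: real assume x: "x \<in> carrier_vec n" and c: "0 \<le> c"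
    show "\<sigma> (c \<cdot>\<^sub>v x) \<le> c * \<sigma> x"
    proof (rule \<sigma>_le)
      fix z assume z: "z \<in> S"
      then have "(c \<cdot>\<^sub>v x) \<bullet> z = c * (x \<bullet> z)" using x Sc by auto
      then show "(c \<cdot>\<^sub>v x) \<bullet> z \<le> c * \<sigma> x" using le_\<sigma>[OF x z] c by (simp add: mult_left_mono)
    qed
  qed
  \<comment> \<open>Shifting the offsets by \<open>V\<close> turns \<open>bound\<close> into the
    sandwich hypothesis for the support function.\<close>
  let ?D = "{(h, a - V) | h a. (h, a) \<in> F}"
  obtain z where z: "z \<in> carrier_vec n" "\<And>y. y \<in> carrier_vec n \<Longrightarrow> z \<bullet> y \<le> \<sigma> y"
    "\<And>h e. (h, e) \<in> ?D \<Longrightarrow> - (z \<bullet> h) \<le> e"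
  proof (rule Hahn_Banach_sandwich[OF sub, of ?D])
    show "?D \<subseteq> carrier_vec n \<times> UNIV" using F by auto
    show "(s \<cdot>\<^sub>v d + t \<cdot>\<^sub>v d', s * e + t * e') \<in> ?D"
      if D: "(d, e) \<in> ?D" "(d', e') \<in> ?D" and st: "0 \<le> s" "0 \<le> t" "s + t = 1" for d e d' e' s t
    proof -
      have "(s \<cdot>\<^sub>v d + t \<cdot>\<^sub>v d', s * (e + V) + t * (e' + V)) \<in> F"
        using D st by (intro conv) auto
      moreover have "s * (e + V) + t * (e' + V) = (s * e + t * e') + (s + t) * V"
        by (simp add: algebra_simps)
      ultimately show ?thesis unfolding st(3) by force
    qed
    show "0 \<le> \<sigma> d + e" if de: "(d, e) \<in> ?D" for d e
    proof -
      have dF: "(d, e + V) \<in> F" using de by auto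
      then have "V \<le> \<sigma> d + (e + V)" using F by (intro bound[OF dF] le_\<sigma>) auto
      then show ?thesis by simp
    qed
  qed blast
  \<comment> \<open>Lying below the support function in every direction rules out a direction that
    separates \<open>z\<close> from \<open>S\<close>.\<close>
  have zS: "z \<in> S"
  proof (rule ccontr)
    assume "z \<notin> S"
    then obtain h c where h: "h \<in> carrier_vec n" "\<And>y. y \<in> S \<Longrightarrow> h \<bullet> y \<le> c" "c < h \<bullet> z"
      using compact_convex_separation[OF S z(1)] by blast
    have "h \<bullet> z \<le> c"
      using z(2)[OF h(1)] \<sigma>_le[OF h(2)] comm_scalar_prod[OF h(1) z(1)] by simp
    then show False using h(3) by simp
  qed
  show thesis
  proof (rule that[OF zS])
    show "V \<le> h \<bullet> z + a" if ha: "(h, a) \<in> F" for h a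
    proof -
      have "- (z \<bullet> h) \<le> a - V" by (rule z(3)) (use ha in blast)
      moreover have "z \<bullet> h = h \<bullet> z" using F ha z(1) by (intro comm_scalar_prod) auto
      ultimately show ?thesis by simp
    qed
  qed
qed

subsection \<open>Partial maximization as a dual infimum\<close>

lemma append_cols_carrier:
  "B \<in> carrier_mat m n \<Longrightarrow> C \<in> carrier_mat m k \<Longrightarrow> append_cols B C \<in> carrier_mat m (n + k)"
  unfolding append_cols_def by simp

lemma transpose_append_cols_mult:
  assumes "B \<in> carrier_mat m n" "C \<in> carrier_mat m k" "\<xi> \<in> carrier_vec m"
  shows "transpose_mat (append_cols B C) *\<^sub>v \<xi> =
    (transpose_mat B *\<^sub>v \<xi>) @\<^sub>v (transpose_mat C *\<^sub>v \<xi>)"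
  unfolding append_cols_def using assms
  by (simp add: mat_mult_append[of _ n m _ k])

text \<open>Since \<open>append_cols\<close> is built from transposes, the product is identified by
  its scalar products with test vectors, across which transposes can be moved.\<close>

lemma append_cols_mult:
  assumes B: "B \<in> carrier_mat m n" and C: "C \<in> carrier_mat m k"
    and z: "z \<in> carrier_vec n" and v: "v \<in> carrier_vec k"
  shows "append_cols B C *\<^sub>v (z @\<^sub>v v) = B *\<^sub>v z + C *\<^sub>v v"
proof (rule vec_eqI_scalar_prod)
  note BC = append_cols_carrier[OF B C]
  show "append_cols B C *\<^sub>v (z @\<^sub>v v) \<in> carrier_vec m" using BC z v by simp
  show "B *\<^sub>v z + C *\<^sub>v v \<in> carrier_vec m" using B C z v by simp
  fix x :: "real Matrix.vec" assume x: "x \<in> carrier_vec m"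
  have "(append_cols B C *\<^sub>v (z @\<^sub>v v)) \<bullet> x = x \<bullet> (append_cols B C *\<^sub>v (z @\<^sub>v v))"
    using BC z v x by (intro comm_scalar_prod[of _ m]) auto
  also have "\<dots> = (transpose_mat (append_cols B C) *\<^sub>v x) \<bullet> (z @\<^sub>v v)"
    using transpose_mult_scalar_prod[OF BC x] z v by simp
  also have "\<dots> = (transpose_mat B *\<^sub>v x) \<bullet> z + (transpose_mat C *\<^sub>v x) \<bullet> v"
    unfolding transpose_append_cols_mult[OF B C x]
    using B C x z v by (intro scalar_prod_append) auto
  also have "\<dots> = x \<bullet> (B *\<^sub>v z) + x \<bullet> (C *\<^sub>v v)"
    using transpose_mult_scalar_prod[OF B x z] transpose_mult_scalar_prod[OF C x v] by simp
  also have "\<dots> = x \<bullet> (B *\<^sub>v z + C *\<^sub>v v)"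
    using B C x z v by (simp add: scalar_prod_add_distrib[of _ m])
  also have "\<dots> = (B *\<^sub>v z + C *\<^sub>v v) \<bullet> x"
    using B C z v x by (intro comm_scalar_prod[of _ m]) auto
  finally show "(append_cols B C *\<^sub>v (z @\<^sub>v v)) \<bullet> x = (B *\<^sub>v z + C *\<^sub>v v) \<bullet> x" .
qed

lemma conic_le_append_cols:
  assumes "A \<in> carrier_mat m k" "B \<in> carrier_mat m n" "C \<in> carrier_mat m n'" "r \<in> carrier_vec m"
    and "w \<in> carrier_vec k" "z \<in> carrier_vec n" "v \<in> carrier_vec n'"
  shows "conic_le L (append_cols B C *\<^sub>v (z @\<^sub>v v)) (r - A *\<^sub>v w) \<longleftrightarrow>
    conic_le L (A *\<^sub>v w + B *\<^sub>v z + C *\<^sub>v v) r"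
proof -
  have "(r - A *\<^sub>v w) - (B *\<^sub>v z + C *\<^sub>v v) = r - (A *\<^sub>v w + B *\<^sub>v z + C *\<^sub>v v)"
    using assms by (intro eq_vecI) (auto simp del: index_mult_mat_vec)
  then show ?thesis
    using append_cols_mult[OF assms(2,3,6,7)] by (simp add: conic_le_def)
qed

lemma conic_le_convex:
  assumes "vec_convex K" "conic_le K x s" "conic_le K y s" "0 \<le> a" "0 \<le> b" "a + b = 1"
    and "x \<in> carrier_vec k" "y \<in> carrier_vec k" "s \<in> carrier_vec k"
  shows "conic_le K (a \<cdot>\<^sub>v x + b \<cdot>\<^sub>v y) s"
proof -
  have "a \<cdot>\<^sub>v (s - x) + b \<cdot>\<^sub>v (s - y) \<in> K"
    using assms by (auto simp: vec_convex_def conic_le_def)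
  moreover have "a \<cdot>\<^sub>v (s - x) + b \<cdot>\<^sub>v (s - y) = s - (a \<cdot>\<^sub>v x + b \<cdot>\<^sub>v y)"
  proof (rule eq_vecI)
    fix i assume "i < dim_vec (s - (a \<cdot>\<^sub>v x + b \<cdot>\<^sub>v y))"
    then have i: "i < k" using assms by simp
    have "(a \<cdot>\<^sub>v (s - x) + b \<cdot>\<^sub>v (s - y)) $ i = (a + b) * s $ i - (a * x $ i + b * y $ i)"
      using assms(7-9) i by (simp add: algebra_simps)
    then show "(a \<cdot>\<^sub>v (s - x) + b \<cdot>\<^sub>v (s - y)) $ i = (s - (a \<cdot>\<^sub>v x + b \<cdot>\<^sub>v y)) $ i"
      using assms(6-9) i by simp
  qed (use assms in auto)
  ultimately show ?thesis by (simp add: conic_le_def)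
qed

lemma conic_le_dual_zero_iff:
  assumes "\<xi> \<in> carrier_vec l"
  shows "conic_le (dual_cone l L) (0\<^sub>v l) \<xi> \<longleftrightarrow> \<xi> \<in> dual_cone l L"
proof -
  have "\<xi> - 0\<^sub>v l = \<xi>" using assms by (intro eq_vecI) auto
  then show ?thesis by (simp add: conic_le_def)
qed

text \<open>The dual value involves \<open>w\<close> through \<open>r - A w\<close>. Regrouped by
  \<open>w\<close> it is affine with slope \<open>f\<close> and offset \<open>t\<close> free of
  \<open>w\<close>, the shape that a representation demands.\<close>

lemma dual_objective:
  fixes A :: "real mat"
  assumes A: "A \<in> carrier_mat l nw" and "g \<in> carrier_vec nw" "\<xi> \<in> carrier_vec l"
    "w \<in> carrier_vec nw" "r \<in> carrier_vec l"
  shows "(g - transpose_mat A *\<^sub>v \<xi>) \<bullet> w + (r \<bullet> \<xi> + \<tau>) = g \<bullet> w + \<tau> + (r - A *\<^sub>v w) \<bullet> \<xi>"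
proof -
  have "(g - transpose_mat A *\<^sub>v \<xi>) \<bullet> w = g \<bullet> w - (transpose_mat A *\<^sub>v \<xi>) \<bullet> w"
    using assms by (intro minus_scalar_prod_distrib[of _ nw]) auto
  also have "(transpose_mat A *\<^sub>v \<xi>) \<bullet> w = (A *\<^sub>v w) \<bullet> \<xi>"
    using transpose_mult_scalar_prod[OF A assms(3,4)] comm_scalar_prod[of \<xi> l "A *\<^sub>v w"] assms by simp
  finally show ?thesis
    using assms by (simp add: minus_scalar_prod_distrib[of r l])
qed

text \<open>Pair \<open>\<xi>\<close> with the slack, which lies in \<open>L\<close>; the equation
  for \<open>C\<close> eliminates \<open>v\<close>.\<close>

lemma weak_duality:
  assumes data: "A \<in> carrier_mat l nw" "B \<in> carrier_mat l nz" "C \<in> carrier_mat l nv" "r \<in> carrier_vec l"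
    and vecs: "w \<in> carrier_vec nw" "z \<in> carrier_vec nz" "v \<in> carrier_vec nv"
    and le: "conic_le L (A *\<^sub>v w + B *\<^sub>v z + C *\<^sub>v v) r"
    and \<xi>: "\<xi> \<in> dual_cone l L" "transpose_mat C *\<^sub>v \<xi> = 0\<^sub>v nv"
  shows "(transpose_mat B *\<^sub>v \<xi>) \<bullet> z \<le> (r - A *\<^sub>v w) \<bullet> \<xi>"
proof -
  have \<xi>c: "\<xi> \<in> carrier_vec l" using \<xi>(1) by (simp add: dual_cone_def)
  have "0 \<le> \<xi> \<bullet> (r - (A *\<^sub>v w + B *\<^sub>v z + C *\<^sub>v v))"
    using \<xi>(1) le by (simp add: dual_cone_def conic_le_def)
  also have "r - (A *\<^sub>v w + B *\<^sub>v z + C *\<^sub>v v) = (r - A *\<^sub>v w) - (B *\<^sub>v z + C *\<^sub>v v)"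
    using data vecs by (intro eq_vecI) (auto simp del: index_mult_mat_vec)
  also have "\<xi> \<bullet> ((r - A *\<^sub>v w) - (B *\<^sub>v z + C *\<^sub>v v))
      = \<xi> \<bullet> (r - A *\<^sub>v w) - (\<xi> \<bullet> (B *\<^sub>v z) + \<xi> \<bullet> (C *\<^sub>v v))"
    using data vecs \<xi>c by (simp add: scalar_prod_minus_distrib[of _ l] scalar_prod_add_distrib[of _ l])
  also have "\<xi> \<bullet> (B *\<^sub>v z) = (transpose_mat B *\<^sub>v \<xi>) \<bullet> z"
    using transpose_mult_scalar_prod[OF data(2) \<xi>c vecs(2)] by simp
  also have "\<xi> \<bullet> (C *\<^sub>v v) = 0"
    using transpose_mult_scalar_prod[OF data(3) \<xi>c vecs(3)] \<xi>(2) vecs(3) by simp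
  also have "\<xi> \<bullet> (r - A *\<^sub>v w) = (r - A *\<^sub>v w) \<bullet> \<xi>"
    using data vecs \<xi>c by (intro comm_scalar_prod[of _ l]) auto
  finally show ?thesis by simp
qed

text \<open>One half is weak duality at the maximiser. For the other, a real \<open>c\<close>
  strictly between the two sides is below every dual value; conic duality at each feasible
  \<open>(g, h, \<tau>, u)\<close> turns this into the hypothesis of the minimax lemma, which
  returns a point of \<open>Z\<close> with value at least \<open>c\<close>, above the
  maximum.\<close>

lemma max_eq_dual_inf:
  fixes \<phi> :: "real Matrix.vec \<Rightarrow> real"
  assumes K: "vec_convex K"
    and psi_data: "G \<in> carrier_mat k nw" "H \<in> carrier_mat k nz" "p \<in> carrier_vec k"
      "Q \<in> carrier_mat k nu" "R \<in> carrier_mat k nx" "s \<in> carrier_vec k"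
    and Y_data: "A \<in> carrier_mat l nw" "B \<in> carrier_mat l nz" "C \<in> carrier_mat l nv"
      "r \<in> carrier_vec l"
    and x: "x \<in> carrier_vec nx" and w: "w \<in> carrier_vec nw"
    and Z: "compactin (vec_topology nz) Z" "vec_convex Z"
    and Z_rep: "\<And>z. z \<in> carrier_vec nz \<Longrightarrow>
      z \<in> Z \<longleftrightarrow> (\<exists>v\<in>carrier_vec nv. conic_le L (A *\<^sub>v w + B *\<^sub>v z + C *\<^sub>v v) r)"
    and ess: "ess_strictly_feasible l L (nz + nv) (append_cols B C) (r - A *\<^sub>v w)"
    and rep: "\<And>z. z \<in> Z \<Longrightarrow> ereal (\<phi> z) =
      Inf {ereal (g \<bullet> w + h \<bullet> z + \<tau>) | g h \<tau> u.
        g \<in> carrier_vec nw \<and> h \<in> carrier_vec nz \<and> u \<in> carrier_vec nu \<and>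
        conic_le K (G *\<^sub>v g + H *\<^sub>v h + \<tau> \<cdot>\<^sub>v p + Q *\<^sub>v u + R *\<^sub>v x) s}"
    and max: "zmax \<in> Z" "\<And>z. z \<in> Z \<Longrightarrow> \<phi> z \<le> \<phi> zmax"
  shows "ereal (\<phi> zmax) =
    Inf {ereal (f \<bullet> w + t) | f t g h \<tau> u \<xi>.
      f \<in> carrier_vec nw \<and> g \<in> carrier_vec nw \<and> h \<in> carrier_vec nz \<and>
      u \<in> carrier_vec nu \<and> \<xi> \<in> carrier_vec l \<and>
      f = g - transpose_mat A *\<^sub>v \<xi> \<and> t = r \<bullet> \<xi> + \<tau> \<and>
      transpose_mat B *\<^sub>v \<xi> = h \<and> transpose_mat C *\<^sub>v \<xi> = 0\<^sub>v nv \<and>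
      conic_le (dual_cone l L) (0\<^sub>v l) \<xi> \<and>
      conic_le K (G *\<^sub>v g + H *\<^sub>v h + \<tau> \<cdot>\<^sub>v p + Q *\<^sub>v u + R *\<^sub>v x) s}"
    (is "_ = Inf ?D")
proof (rule antisym)
  let ?E = "\<lambda>g h \<tau> u. G *\<^sub>v g + H *\<^sub>v h + \<tau> \<cdot>\<^sub>v p + Q *\<^sub>v u + R *\<^sub>v x"
  have Zc: "Z \<subseteq> carrier_vec nz" using compactin_subset_topspace[OF Z(1)] by simp
  have \<phi>_le: "\<phi> z \<le> g \<bullet> w + h \<bullet> z + \<tau>"
    if "z \<in> Z" "g \<in> carrier_vec nw" "h \<in> carrier_vec nz" "u \<in> carrier_vec nu"
      "conic_le K (?E g h \<tau> u) s" for z g h \<tau> u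
  proof -
    have "ereal (\<phi> z) \<le> ereal (g \<bullet> w + h \<bullet> z + \<tau>)"
      unfolding rep[OF that(1)] using that by (intro Inf_lower) blast
    then show ?thesis by simp
  qed
  show "ereal (\<phi> zmax) \<le> Inf ?D"
  proof (rule Inf_greatest, safe)
    fix g \<tau> u \<xi>
    assume g: "g \<in> carrier_vec nw" and u: "u \<in> carrier_vec nu" and \<xi>: "\<xi> \<in> carrier_vec l"
      and h: "transpose_mat B *\<^sub>v \<xi> \<in> carrier_vec nz"
      and C0: "transpose_mat C *\<^sub>v \<xi> = 0\<^sub>v nv" and dual: "conic_le (dual_cone l L) (0\<^sub>v l) \<xi>"
      and le: "conic_le K (?E g (transpose_mat B *\<^sub>v \<xi>) \<tau> u) s"
    obtain v where v: "v \<in> carrier_vec nv" "conic_le L (A *\<^sub>v w + B *\<^sub>v zmax + C *\<^sub>v v) r"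
      using max(1) Z_rep Zc by blast
    have "\<phi> zmax \<le> g \<bullet> w + (transpose_mat B *\<^sub>v \<xi>) \<bullet> zmax + \<tau>"
      by (rule \<phi>_le[OF max(1) g h u le])
    also have "(transpose_mat B *\<^sub>v \<xi>) \<bullet> zmax \<le> (r - A *\<^sub>v w) \<bullet> \<xi>"
      using max(1) Zc dual \<xi> by (intro weak_duality[OF Y_data w _ v _ C0]) (auto simp: conic_le_dual_zero_iff)
    finally show "ereal (\<phi> zmax) \<le> ereal ((g - transpose_mat A *\<^sub>v \<xi>) \<bullet> w + (r \<bullet> \<xi> + \<tau>))"
      unfolding dual_objective[OF Y_data(1) g \<xi> w Y_data(4)] by simp
  qed
  show "Inf ?D \<le> ereal (\<phi> zmax)"
  proof (rule ccontr)
    assume "\<not> ?thesis"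
    then obtain c where c: "ereal (\<phi> zmax) < ereal c" "ereal c < Inf ?D"
      unfolding not_le by (auto dest: ereal_dense2)
    have c_le: "c \<le> g \<bullet> w + \<tau> + (r - A *\<^sub>v w) \<bullet> \<xi>"
      if g: "g \<in> carrier_vec nw" and u: "u \<in> carrier_vec nu"
        and \<xi>: "\<xi> \<in> dual_cone l L" "transpose_mat C *\<^sub>v \<xi> = 0\<^sub>v nv"
        and le: "conic_le K (?E g (transpose_mat B *\<^sub>v \<xi>) \<tau> u) s" for g \<tau> u \<xi>
    proof -
      have \<xi>c: "\<xi> \<in> carrier_vec l" using \<xi>(1) by (simp add: dual_cone_def)
      let ?f = "g - transpose_mat A *\<^sub>v \<xi>"
      have "?f \<in> carrier_vec nw" "transpose_mat B *\<^sub>v \<xi> \<in> carrier_vec nz"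
        using g Y_data \<xi>c by auto
      then have "ereal (?f \<bullet> w + (r \<bullet> \<xi> + \<tau>)) \<in> ?D"
        using g u \<xi> \<xi>c le conic_le_dual_zero_iff[OF \<xi>c, of L]
        by - (rule CollectI, rule exI[of _ ?f], rule exI[of _ "r \<bullet> \<xi> + \<tau>"], rule exI[of _ g],
          rule exI[of _ "transpose_mat B *\<^sub>v \<xi>"], rule exI[of _ \<tau>], rule exI[of _ u], rule exI[of _ \<xi>], simp)
      then have "Inf ?D \<le> ereal (?f \<bullet> w + (r \<bullet> \<xi> + \<tau>))" by (rule Inf_lower)
      with c(2) have "ereal c < ereal (?f \<bullet> w + (r \<bullet> \<xi> + \<tau>))" by (rule less_le_trans)
      then show ?thesis unfolding dual_objective[OF Y_data(1) g \<xi>c w Y_data(4)] by simp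
    qed
    \<comment> \<open>With \<open>w\<close> fixed, a feasible tuple matters only through the slope
      and the offset of its affine function of \<open>z\<close>.\<close>
    let ?F = "{(h, g \<bullet> w + \<tau>) | g h \<tau> u. g \<in> carrier_vec nw \<and> h \<in> carrier_vec nz \<and>
      u \<in> carrier_vec nu \<and> conic_le K (?E g h \<tau> u) s}"
    obtain z where z: "z \<in> Z" "\<And>h a. (h, a) \<in> ?F \<Longrightarrow> c \<le> h \<bullet> z + a"
    proof (rule minimax_affine[OF Z, of ?F c])
      show "Z \<noteq> {}" using max(1) by auto
      show "?F \<subseteq> carrier_vec nz \<times> UNIV" by auto
      show "(b \<cdot>\<^sub>v h + d \<cdot>\<^sub>v h', b * a + d * a') \<in> ?F"
        if F: "(h, a) \<in> ?F" "(h', a') \<in> ?F" and bd: "0 \<le> b" "0 \<le> d" "b + d = 1" for h a h' a' b d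
      proof -
        obtain g \<tau> u where 1: "g \<in> carrier_vec nw" "h \<in> carrier_vec nz" "u \<in> carrier_vec nu"
          "a = g \<bullet> w + \<tau>" "conic_le K (?E g h \<tau> u) s" using F(1) by blast
        obtain g' \<tau>' u' where 2: "g' \<in> carrier_vec nw" "h' \<in> carrier_vec nz" "u' \<in> carrier_vec nu"
          "a' = g' \<bullet> w + \<tau>'" "conic_le K (?E g' h' \<tau>' u') s" using F(2) by blast
        let ?g = "b \<cdot>\<^sub>v g + d \<cdot>\<^sub>v g'" and ?h = "b \<cdot>\<^sub>v h + d \<cdot>\<^sub>v h'"
          and ?u = "b \<cdot>\<^sub>v u + d \<cdot>\<^sub>v u'" and ?\<tau> = "b * \<tau> + d * \<tau>'"
        \<comment> \<open>The term \<open>R x\<close> is constant in the tuple; it is reproduced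
          because the weights sum to \<open>1\<close>.\<close>
        have "?E ?g ?h ?\<tau> ?u = b \<cdot>\<^sub>v ?E g h \<tau> u + d \<cdot>\<^sub>v ?E g' h' \<tau>' u'"
        proof (rule eq_vecI)
          fix i assume "i < dim_vec (b \<cdot>\<^sub>v ?E g h \<tau> u + d \<cdot>\<^sub>v ?E g' h' \<tau>' u')"
          then have i: "i < k" using psi_data by simp
          have "(b \<cdot>\<^sub>v ?E g h \<tau> u + d \<cdot>\<^sub>v ?E g' h' \<tau>' u') $ i
              = b * (G *\<^sub>v g) $ i + d * (G *\<^sub>v g') $ i + (b * (H *\<^sub>v h) $ i + d * (H *\<^sub>v h') $ i)
                + ?\<tau> * p $ i + (b * (Q *\<^sub>v u) $ i + d * (Q *\<^sub>v u') $ i) + (b + d) * (R *\<^sub>v x) $ i"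
            using psi_data i by (simp add: algebra_simps del: index_mult_mat_vec)
          also have "\<dots> = ?E ?g ?h ?\<tau> ?u $ i"
            unfolding bd(3) mult_mat_vec_comb[OF psi_data(1) 1(1) 2(1)]
              mult_mat_vec_comb[OF psi_data(2) 1(2) 2(2)] mult_mat_vec_comb[OF psi_data(4) 1(3) 2(3)]
            using psi_data i by (simp del: index_mult_mat_vec)
          finally show "?E ?g ?h ?\<tau> ?u $ i = (b \<cdot>\<^sub>v ?E g h \<tau> u + d \<cdot>\<^sub>v ?E g' h' \<tau>' u') $ i" ..
        qed (use psi_data in auto)
        then have "conic_le K (?E ?g ?h ?\<tau> ?u) s"
          using conic_le_convex[OF K 1(5) 2(5) bd, of k] psi_data x 1 2 by auto
        moreover have "b * a + d * a' = ?g \<bullet> w + ?\<tau>"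
          using 1 2 w by (simp add: add_scalar_prod_distrib[of _ nw] algebra_simps)
        moreover have "?g \<in> carrier_vec nw" "?h \<in> carrier_vec nz" "?u \<in> carrier_vec nu"
          using 1 2 by auto
        ultimately show ?thesis by blast
      qed
      show "c \<le> b + a" if F: "(h, a) \<in> ?F" and b: "\<And>z. z \<in> Z \<Longrightarrow> h \<bullet> z \<le> b" for h a b
      proof -
        obtain g \<tau> u where 1: "g \<in> carrier_vec nw" "h \<in> carrier_vec nz" "u \<in> carrier_vec nu"
          "a = g \<bullet> w + \<tau>" "conic_le K (?E g h \<tau> u) s" using F by blast
        \<comment> \<open>The objective on pairs \<open>(z, v)\<close> that ignores
          \<open>v\<close>; its zero block becomes the equation for \<open>C\<close> and
          \<open>\<xi>\<close>.\<close>
        have h0: "h @\<^sub>v 0\<^sub>v nv \<in> carrier_vec (nz + nv)" using 1 by simp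
        have bnd: "(h @\<^sub>v 0\<^sub>v nv) \<bullet> y \<le> b"
          if y: "y \<in> carrier_vec (nz + nv)" and le: "conic_le L (append_cols B C *\<^sub>v y) (r - A *\<^sub>v w)" for y
        proof -
          obtain z v where zv: "y = z @\<^sub>v v" "z \<in> carrier_vec nz" "v \<in> carrier_vec nv"
            using vec_first_last_append[OF y] vec_first_carrier vec_last_carrier by metis
          have "z \<in> Z"
            using le zv Z_rep[OF zv(2)] conic_le_append_cols[OF Y_data w zv(2,3)] by auto
          moreover have "(h @\<^sub>v 0\<^sub>v nv) \<bullet> y = h \<bullet> z"
            using zv scalar_prod_append[OF 1(2) _ zv(2,3), of "0\<^sub>v nv"] by simp
          ultimately show ?thesis using b by simp
        qed
        obtain \<xi> where \<xi>: "\<xi> \<in> dual_cone l L"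
          "transpose_mat (append_cols B C) *\<^sub>v \<xi> = h @\<^sub>v 0\<^sub>v nv" "(r - A *\<^sub>v w) \<bullet> \<xi> \<le> b"
          using ess_strictly_feasible_duality[OF ess h0 bnd] by blast
        have \<xi>c: "\<xi> \<in> carrier_vec l" using \<xi>(1) by (simp add: dual_cone_def)
        have "transpose_mat B *\<^sub>v \<xi> = h \<and> transpose_mat C *\<^sub>v \<xi> = 0\<^sub>v nv"
          using \<xi>(2) 1(2) Y_data \<xi>c unfolding transpose_append_cols_mult[OF Y_data(2,3) \<xi>c]
          by (subst (asm) append_vec_eq[of _ nz]) auto
        then show ?thesis using c_le[OF 1(1,3) \<xi>(1), of \<tau>] 1 \<xi>(3) by simp
      qed
    qed blast
    \<comment> \<open>At this single \<open>z\<close> the level \<open>c\<close> bounds the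
      objective of all feasible tuples, hence their infimum \<open>\<phi> z\<close>.\<close>
    have "ereal c \<le> ereal (\<phi> z)"
      unfolding rep[OF z(1)]
    proof (rule Inf_greatest, safe)
      fix g h \<tau> u
      assume "g \<in> carrier_vec nw" "h \<in> carrier_vec nz" "u \<in> carrier_vec nu" "conic_le K (?E g h \<tau> u) s"
      then have "(h, g \<bullet> w + \<tau>) \<in> ?F" by blast
      from z(2)[OF this] show "ereal c \<le> ereal (g \<bullet> w + h \<bullet> z + \<tau>)" by simp
    qed
    with c(1) max(2)[OF z(1)] show False by simp
  qed
qed

subsection \<open>Systems of conic constraints\<close>

text \<open>Linearity as a property with closure rules, so that coefficient rows in the stacked
  variable need not be written out.\<close>

definition linear_form :: "nat \<Rightarrow> (real Matrix.vec \<Rightarrow> real) \<Rightarrow> bool" where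
  "linear_form n \<phi> \<longleftrightarrow> (\<exists>d\<in>carrier_vec n. \<forall>e\<in>carrier_vec n. \<phi> e = d \<bullet> e)"

lemma linear_form_zero: "linear_form n (\<lambda>e. 0)"
  unfolding linear_form_def by (intro bexI[of _ "0\<^sub>v n"]) auto

lemma linear_form_index: "i < n \<Longrightarrow> linear_form n (\<lambda>e. e $ i)"
  unfolding linear_form_def by (intro bexI[of _ "unit_vec n i"]) auto

lemma linear_form_cmult:
  assumes "linear_form n \<phi>"
  shows "linear_form n (\<lambda>e. c * \<phi> e)"
proof -
  from assms obtain d where "d \<in> carrier_vec n" "\<forall>e\<in>carrier_vec n. \<phi> e = d \<bullet> e"
    unfolding linear_form_def by blast
  then show ?thesis unfolding linear_form_def by (intro bexI[of _ "c \<cdot>\<^sub>v d"]) auto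
qed

lemma linear_form_mult_right: "linear_form n \<phi> \<Longrightarrow> linear_form n (\<lambda>e. \<phi> e * c)"
  using linear_form_cmult[of n \<phi> c] by (simp add: mult.commute)

lemma linear_form_uminus: "linear_form n \<phi> \<Longrightarrow> linear_form n (\<lambda>e. - \<phi> e)"
  using linear_form_cmult[of n \<phi> "- 1"] by simp

lemma linear_form_add:
  assumes "linear_form n \<phi>" "linear_form n \<phi>'"
  shows "linear_form n (\<lambda>e. \<phi> e + \<phi>' e)"
proof -
  from assms obtain d d' where "d \<in> carrier_vec n" "\<forall>e\<in>carrier_vec n. \<phi> e = d \<bullet> e"
    "d' \<in> carrier_vec n" "\<forall>e\<in>carrier_vec n. \<phi>' e = d' \<bullet> e"
    unfolding linear_form_def by blast
  then show ?thesis unfolding linear_form_def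
    by (intro bexI[of _ "d + d'"]) (auto simp: add_scalar_prod_distrib[of _ n])
qed

lemma linear_form_sum:
  assumes "\<And>i. i \<in> I \<Longrightarrow> linear_form n (\<lambda>e. \<phi> i e)"
  shows "linear_form n (\<lambda>e. \<Sum>i\<in>I. \<phi> i e)"
  using assms
  by (induction I rule: infinite_finite_induct) (auto intro: linear_form_zero linear_form_add)

section \<open>Blocks of a stacked variable\<close>

definition vec_slice :: "nat \<Rightarrow> nat \<Rightarrow> real Matrix.vec \<Rightarrow> real Matrix.vec" where
  "vec_slice j m e = Matrix.vec m (\<lambda>i. e $ (j + i))"

lemma vec_slice_carrier [simp]: "vec_slice j m e \<in> carrier_vec m"
  by (simp add: vec_slice_def)

lemma dim_vec_slice [simp]: "dim_vec (vec_slice j m e) = m"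
  by (simp add: vec_slice_def)

lemma linear_form_scalar_prod_slice:
  assumes "a \<in> carrier_vec m" "j + m \<le> n"
  shows "linear_form n (\<lambda>e. a \<bullet> vec_slice j m e)"
proof -
  have "linear_form n (\<lambda>e. \<Sum>i\<in>{0..<m}. a $ i * e $ (j + i))"
    using assms by (intro linear_form_sum linear_form_cmult linear_form_index) auto
  then show ?thesis by (simp add: scalar_prod_def vec_slice_def)
qed

lemma linear_form_mult_mat_vec_slice:
  assumes "A \<in> carrier_mat k m" "j + m \<le> n" "i < k"
  shows "linear_form n (\<lambda>e. (A *\<^sub>v vec_slice j m e) $ i)"
  using linear_form_scalar_prod_slice[of "row A i" m j n] assms by simp

lemma conic_system_cong:
  assumes "conic_system \<K> ny nu nx \<Phi>"
    and "\<And>f t u x. \<lbrakk>f \<in> carrier_vec ny; u \<in> carrier_vec nu; x \<in> carrier_vec nx\<rbrakk>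
      \<Longrightarrow> \<Phi>' f t u x \<longleftrightarrow> \<Phi> f t u x"
  shows "conic_system \<K> ny nu nx \<Phi>'"
  using assms unfolding conic_system_def by simp

text \<open>Rows are stacked over the product cone; because \<open>K\<close> lives in dimension
  \<open>m\<close>, the stacked slack splits in only one way.\<close>

lemma conic_system_conj:
  assumes fam: "cone_family \<K>"
    and 1: "conic_system \<K> ny nu nx \<Phi>" and 2: "conic_system \<K> ny nu nx \<Psi>"
  shows "conic_system \<K> ny nu nx (\<lambda>f t u x. \<Phi> f t u x \<and> \<Psi> f t u x)"
proof -
  obtain m K P p Q R s where 1: "K \<in> \<K> m" "P \<in> carrier_mat m ny" "p \<in> carrier_vec m"
    "Q \<in> carrier_mat m nu" "R \<in> carrier_mat m nx" "s \<in> carrier_vec m"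
    "\<forall>f\<in>carrier_vec ny. \<forall>t. \<forall>u\<in>carrier_vec nu. \<forall>x\<in>carrier_vec nx.
      \<Phi> f t u x \<longleftrightarrow> conic_le K (P *\<^sub>v f + t \<cdot>\<^sub>v p + Q *\<^sub>v u + R *\<^sub>v x) s"
    using 1 unfolding conic_system_def by blast
  obtain m' K' P' p' Q' R' s' where 2: "K' \<in> \<K> m'" "P' \<in> carrier_mat m' ny" "p' \<in> carrier_vec m'"
    "Q' \<in> carrier_mat m' nu" "R' \<in> carrier_mat m' nx" "s' \<in> carrier_vec m'"
    "\<forall>f\<in>carrier_vec ny. \<forall>t. \<forall>u\<in>carrier_vec nu. \<forall>x\<in>carrier_vec nx.
      \<Psi> f t u x \<longleftrightarrow> conic_le K' (P' *\<^sub>v f + t \<cdot>\<^sub>v p' + Q' *\<^sub>v u + R' *\<^sub>v x) s'"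
    using 2 unfolding conic_system_def by blast
  have Kc: "K \<subseteq> carrier_vec m"
    using fam 1(1) regular_cone_carrier unfolding cone_family_def by blast
  show ?thesis
    unfolding conic_system_def
  proof (rule exI[of _ "m + m'"], rule bexI[of _ "cone_prod K K'"], rule bexI[of _ "P @\<^sub>r P'"],
      rule bexI[of _ "p @\<^sub>v p'"], rule bexI[of _ "Q @\<^sub>r Q'"], rule bexI[of _ "R @\<^sub>r R'"],
      rule bexI[of _ "s @\<^sub>v s'"], intro ballI allI)
    show "cone_prod K K' \<in> \<K> (m + m')" using fam 1(1) 2(1) unfolding cone_family_def by blast
    show "P @\<^sub>r P' \<in> carrier_mat (m + m') ny" "p @\<^sub>v p' \<in> carrier_vec (m + m')"
      "Q @\<^sub>r Q' \<in> carrier_mat (m + m') nu" "R @\<^sub>r R' \<in> carrier_mat (m + m') nx"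
      "s @\<^sub>v s' \<in> carrier_vec (m + m')" using 1 2 by auto
    fix f u x :: "real Matrix.vec" and t assume c: "f \<in> carrier_vec ny" "u \<in> carrier_vec nu" "x \<in> carrier_vec nx"
    have "(P @\<^sub>r P') *\<^sub>v f + t \<cdot>\<^sub>v (p @\<^sub>v p') + (Q @\<^sub>r Q') *\<^sub>v u + (R @\<^sub>r R') *\<^sub>v x
        = (P *\<^sub>v f + t \<cdot>\<^sub>v p + Q *\<^sub>v u + R *\<^sub>v x) @\<^sub>v (P' *\<^sub>v f + t \<cdot>\<^sub>v p' + Q' *\<^sub>v u + R' *\<^sub>v x)"
      unfolding mat_mult_append[OF 1(2) 2(2) c(1)] mat_mult_append[OF 1(4) 2(4) c(2)]
        mat_mult_append[OF 1(5) 2(5) c(3)]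
      using 1(2-6) 2(2-6) by (intro eq_vecI) (auto simp del: index_mult_mat_vec)
    moreover have "conic_le (cone_prod K K')
        ((P *\<^sub>v f + t \<cdot>\<^sub>v p + Q *\<^sub>v u + R *\<^sub>v x) @\<^sub>v (P' *\<^sub>v f + t \<cdot>\<^sub>v p' + Q' *\<^sub>v u + R' *\<^sub>v x)) (s @\<^sub>v s')
        \<longleftrightarrow> conic_le K (P *\<^sub>v f + t \<cdot>\<^sub>v p + Q *\<^sub>v u + R *\<^sub>v x) s \<and>
            conic_le K' (P' *\<^sub>v f + t \<cdot>\<^sub>v p' + Q' *\<^sub>v u + R' *\<^sub>v x) s'"
      using 1 2 c Kc by (intro conic_le_cone_prod_append[of _ m _ _ m']) auto
    ultimately show "\<Phi> f t u x \<and> \<Psi> f t u x \<longleftrightarrow> conic_le (cone_prod K K')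
        ((P @\<^sub>r P') *\<^sub>v f + t \<cdot>\<^sub>v (p @\<^sub>v p') + (Q @\<^sub>r Q') *\<^sub>v u + (R @\<^sub>r R') *\<^sub>v x) (s @\<^sub>v s')"
      using 1(7) 2(7) c by simp
  qed
qed

text \<open>Carrying \<open>\<Psi>\<close> along settles \<open>n = 0\<close>, where a trivially
  true conic constraint would otherwise have to be constructed.\<close>

lemma conic_system_all_conj:
  fixes n :: nat
  assumes fam: "cone_family \<K>" and "conic_system \<K> ny nu nx \<Psi>"
    and "\<And>i. i < n \<Longrightarrow> conic_system \<K> ny nu nx (\<Phi> i)"
  shows "conic_system \<K> ny nu nx (\<lambda>f t u x. (\<forall>i<n. \<Phi> i f t u x) \<and> \<Psi> f t u x)"
  using assms(3)
proof (induction n)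
  case 0
  then show ?case using assms(2) by simp
next
  case (Suc n)
  have "conic_system \<K> ny nu nx
      (\<lambda>f t u x. \<Phi> n f t u x \<and> ((\<forall>i<n. \<Phi> i f t u x) \<and> \<Psi> f t u x))"
    using Suc by (intro conic_system_conj[OF fam, of ny nu nx "\<Phi> n"]) auto
  then show ?case by (rule conic_system_cong) (auto simp: less_Suc_eq)
qed

text \<open>The vectors that represent the coordinates of \<open>q\<close> are the rows of the
  matrix acting on \<open>u\<close>.\<close>

lemma conic_system_linear:
  assumes K: "K \<in> \<K> m" and c: "s \<in> carrier_vec m" "R \<in> carrier_mat m nx"
    "P \<in> carrier_mat m ny" "p \<in> carrier_vec m"
    and q: "\<And>u. u \<in> carrier_vec nu \<Longrightarrow> q u \<in> carrier_vec m"
    and lin: "\<And>i. i < m \<Longrightarrow> linear_form nu (\<lambda>u. q u $ i)"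
  shows "conic_system \<K> ny nu nx (\<lambda>f t u x. conic_le K (P *\<^sub>v f + t \<cdot>\<^sub>v p + q u + R *\<^sub>v x) s)"
proof -
  obtain d where d: "\<And>i. i < m \<Longrightarrow> d i \<in> carrier_vec nu"
    "\<And>i u. i < m \<Longrightarrow> u \<in> carrier_vec nu \<Longrightarrow> q u $ i = d i \<bullet> u"
    using lin unfolding linear_form_def by metis
  let ?Q = "Matrix.mat m nu (\<lambda>(i, j). d i $ j)"
  have "q u = ?Q *\<^sub>v u" if u: "u \<in> carrier_vec nu" for u
  proof (rule eq_vecI)
    fix i assume "i < dim_vec (?Q *\<^sub>v u)"
    then have i: "i < m" by simp
    have "row ?Q i = d i" using d(1)[OF i] i by (intro eq_vecI) auto
    then show "q u $ i = (?Q *\<^sub>v u) $ i" using d(2)[OF i u] i by simp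
  qed (use q[OF u] in auto)
  then show ?thesis
    unfolding conic_system_def using K c
    by (intro exI[of _ m] bexI[of _ K] bexI[of _ P] bexI[of _ p] bexI[of _ ?Q] bexI[of _ R] bexI[of _ s])
      auto
qed

lemma conic_system_scalar_le:
  assumes fam: "cone_family \<K>" and a: "a \<in> carrier_vec ny" and \<phi>: "linear_form nu \<phi>"
  shows "conic_system \<K> ny nu nx (\<lambda>f t u x. a \<bullet> f + b * t + \<phi> u \<le> c)"
proof -
  let ?P = "Matrix.mat 1 ny (\<lambda>(i, j). a $ j)"
  let ?v = "\<lambda>c. Matrix.vec 1 (\<lambda>_. c) :: real Matrix.vec"
  have "row ?P 0 = a" using a by (intro eq_vecI) auto
  then have P: "?P *\<^sub>v f = ?v (a \<bullet> f)" for f by (intro eq_vecI) auto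
  have "conic_system \<K> ny nu nx (\<lambda>f t u x.
      conic_le (nonneg_orthant 1) (?P *\<^sub>v f + t \<cdot>\<^sub>v ?v b + ?v (\<phi> u) + 0\<^sub>m 1 nx *\<^sub>v x) (?v c))"
    using fam \<phi> by (intro conic_system_linear) (auto simp: cone_family_def)
  then show ?thesis
  proof (rule conic_system_cong)
    fix f u x :: "real Matrix.vec" and t assume "x \<in> carrier_vec nx"
    then have "?v c - (?P *\<^sub>v f + t \<cdot>\<^sub>v ?v b + ?v (\<phi> u) + 0\<^sub>m 1 nx *\<^sub>v x) = ?v (c - (a \<bullet> f + b * t + \<phi> u))"
      unfolding P by (intro eq_vecI) auto
    then show "a \<bullet> f + b * t + \<phi> u \<le> c \<longleftrightarrow> conic_le (nonneg_orthant 1)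
        (?P *\<^sub>v f + t \<cdot>\<^sub>v ?v b + ?v (\<phi> u) + 0\<^sub>m 1 nx *\<^sub>v x) (?v c)"
      unfolding conic_le_def by (simp add: nonneg_orthant_def)
  qed
qed

text \<open>The zero cone on the line has empty interior and so is not regular; an equation
  therefore enters as two opposite inequalities.\<close>

lemma conic_system_scalar_eq:
  assumes fam: "cone_family \<K>" and a: "a \<in> carrier_vec ny" and \<phi>: "linear_form nu \<phi>"
  shows "conic_system \<K> ny nu nx (\<lambda>f t u x. a \<bullet> f + b * t + \<phi> u = 0)"
proof -
  have "conic_system \<K> ny nu nx
      (\<lambda>f t u x. a \<bullet> f + b * t + \<phi> u \<le> 0 \<and> (- a) \<bullet> f + (- b) * t + - \<phi> u \<le> 0)"
    using a \<phi> by (intro conic_system_conj[OF fam] conic_system_scalar_le[OF fam] linear_form_uminus) auto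
  then show ?thesis
    by (rule conic_system_cong) (use a in auto)
qed

text \<open>Together with the converse below: tuples correspond one to one to stacked vectors. The
  block of \<open>\<tau>\<close> has length \<open>1\<close>, hence the \<open>+ 1\<close> in the
  later offsets.\<close>

lemma append_slices:
  assumes "e \<in> carrier_vec (nw + (nz + (1 + (nu + l))))"
  shows "e = vec_slice 0 nw e @\<^sub>v vec_slice nw nz e @\<^sub>v vec_of_list [e $ (nw + nz)] @\<^sub>v
    vec_slice (nw + nz + 1) nu e @\<^sub>v vec_slice (nw + nz + 1 + nu) l e"
proof (rule eq_vecI)
  let ?a = "vec_slice 0 nw e @\<^sub>v vec_slice nw nz e @\<^sub>v vec_of_list [e $ (nw + nz)] @\<^sub>v
    vec_slice (nw + nz + 1) nu e @\<^sub>v vec_slice (nw + nz + 1 + nu) l e"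
  show "dim_vec e = dim_vec ?a" using assms by simp
  fix i assume "i < dim_vec ?a"
  then have i: "i < nw + (nz + (1 + (nu + l)))" by simp
  show "e $ i = ?a $ i"
    using i by (auto simp: vec_slice_def vec_index_vCons not_less intro!: arg_cong[of _ _ "($) e"])
qed

lemma slices_append:
  assumes "g \<in> carrier_vec nw" "h \<in> carrier_vec nz" "u \<in> carrier_vec nu" "\<xi> \<in> carrier_vec l"
    and e: "e = g @\<^sub>v h @\<^sub>v vec_of_list [\<tau>] @\<^sub>v u @\<^sub>v \<xi>"
  shows "vec_slice 0 nw e = g" "vec_slice nw nz e = h" "e $ (nw + nz) = \<tau>"
    "vec_slice (nw + nz + 1) nu e = u" "vec_slice (nw + nz + 1 + nu) l e = \<xi>"
  unfolding e using assms(1-4)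
  by (auto simp: vec_slice_def vec_index_vCons intro!: eq_vecI)

text \<open>The stacked \<open>e\<close> is the auxiliary variable of the new representation. It
  determines its blocks, so the existential quantifiers reduce to evaluation at slices, and what
  remains is a conjunction of constraints linear in \<open>e\<close>.\<close>

lemma conic_system_partial_max:
  assumes fam: "cone_family \<K>" and K: "K \<in> \<K> k" and L: "L \<in> \<K> l"
    and psi_data: "G \<in> carrier_mat k nw" "H \<in> carrier_mat k nz" "p \<in> carrier_vec k"
      "Q \<in> carrier_mat k nu" "R \<in> carrier_mat k nx" "s \<in> carrier_vec k"
    and Y_data: "A \<in> carrier_mat l nw" "B \<in> carrier_mat l nz" "C \<in> carrier_mat l nv"
      "r \<in> carrier_vec l"
  shows "conic_system \<K> nw (nw + (nz + (1 + (nu + l)))) nx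
    (\<lambda>f t e x. \<exists>g\<in>carrier_vec nw. \<exists>h\<in>carrier_vec nz. \<exists>\<tau>.
       \<exists>u\<in>carrier_vec nu. \<exists>\<xi>\<in>carrier_vec l.
         e = g @\<^sub>v h @\<^sub>v vec_of_list [\<tau>] @\<^sub>v u @\<^sub>v \<xi> \<and>
         f = g - transpose_mat A *\<^sub>v \<xi> \<and> t = r \<bullet> \<xi> + \<tau> \<and>
         transpose_mat B *\<^sub>v \<xi> = h \<and> transpose_mat C *\<^sub>v \<xi> = 0\<^sub>v nv \<and>
         conic_le (dual_cone l L) (0\<^sub>v l) \<xi> \<and>
         conic_le K (G *\<^sub>v g + H *\<^sub>v h + \<tau> \<cdot>\<^sub>v p + Q *\<^sub>v u + R *\<^sub>v x) s)"
proof -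
  let ?N = "nw + (nz + (1 + (nu + l)))"
  let ?g = "vec_slice 0 nw" and ?h = "vec_slice nw nz" and ?\<tau> = "\<lambda>e. e $ (nw + nz)"
    and ?u = "vec_slice (nw + nz + 1) nu" and ?\<xi> = "vec_slice (nw + nz + 1 + nu) l"
  let ?sys = "\<lambda>f t g h \<tau> u \<xi> x. f = g - transpose_mat A *\<^sub>v \<xi> \<and> t = r \<bullet> \<xi> + \<tau> \<and>
         transpose_mat B *\<^sub>v \<xi> = h \<and> transpose_mat C *\<^sub>v \<xi> = 0\<^sub>v nv \<and>
         conic_le (dual_cone l L) (0\<^sub>v l) \<xi> \<and>
         conic_le K (G *\<^sub>v g + H *\<^sub>v h + \<tau> \<cdot>\<^sub>v p + Q *\<^sub>v u + R *\<^sub>v x) s"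
  note lin = linear_form_add linear_form_uminus linear_form_index linear_form_mult_right
    linear_form_mult_mat_vec_slice linear_form_scalar_prod_slice
  let ?kon = "\<lambda>f t e x. conic_le K (0\<^sub>m k nw *\<^sub>v f + t \<cdot>\<^sub>v 0\<^sub>v k +
      (G *\<^sub>v ?g e + H *\<^sub>v ?h e + ?\<tau> e \<cdot>\<^sub>v p + Q *\<^sub>v ?u e) + R *\<^sub>v x) s"
  \<comment> \<open>The constraint \<open>\<xi> >= 0\<close> is rewritten as
    \<open>- \<xi> <= 0\<close> to bring the variable to the left.\<close>
  let ?dual = "\<lambda>f t e x. conic_le (dual_cone l L)
      (0\<^sub>m l nw *\<^sub>v f + t \<cdot>\<^sub>v 0\<^sub>v l + (- ?\<xi> e) + 0\<^sub>m l nx *\<^sub>v x) (0\<^sub>v l)"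
  \<comment> \<open>Vector equations are taken row by row; entry \<open>i\<close> of
    \<open>e\<close> is entry \<open>i\<close> of \<open>g\<close>, and entry \<open>nw + i\<close>
    is entry \<open>i\<close> of \<open>h\<close>.\<close>
  let ?f = "\<lambda>i f t e x. unit_vec nw i \<bullet> f + 0 * t + (- (e $ i) + (transpose_mat A *\<^sub>v ?\<xi> e) $ i) = 0"
  let ?t = "\<lambda>f t e x. 0\<^sub>v nw \<bullet> f + 1 * t + (- (r \<bullet> ?\<xi> e) + - ?\<tau> e) = 0"
  let ?b = "\<lambda>i f t e x. 0\<^sub>v nw \<bullet> f + 0 * t + ((transpose_mat B *\<^sub>v ?\<xi> e) $ i + - e $ (nw + i)) = 0"
  let ?c = "\<lambda>i f t e x. 0\<^sub>v nw \<bullet> f + 0 * t + (transpose_mat C *\<^sub>v ?\<xi> e) $ i = 0"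
  have kon: "conic_system \<K> nw ?N nx ?kon"
  proof (rule conic_system_linear[where m = k])
    fix i assume i: "i < k"
    have "linear_form ?N (\<lambda>e. (G *\<^sub>v ?g e) $ i + (H *\<^sub>v ?h e) $ i + ?\<tau> e * p $ i + (Q *\<^sub>v ?u e) $ i)"
      using psi_data i by (intro lin) auto
    then show "linear_form ?N (\<lambda>e. (G *\<^sub>v ?g e + H *\<^sub>v ?h e + ?\<tau> e \<cdot>\<^sub>v p + Q *\<^sub>v ?u e) $ i)"
      using psi_data i by (simp del: index_mult_mat_vec)
  qed (use psi_data K in auto)
  have dual: "conic_system \<K> nw ?N nx ?dual"
  proof (rule conic_system_linear[where m = l])
    show "dual_cone l L \<in> \<K> l" using fam L unfolding cone_family_def by blast
    fix i assume i: "i < l"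
    have "linear_form ?N (\<lambda>e. - (e $ (nw + nz + 1 + nu + i)))"
      using i by (intro lin) auto
    then show "linear_form ?N (\<lambda>e. (- ?\<xi> e) $ i)"
      using i by (simp add: vec_slice_def)
  qed auto
  have f: "conic_system \<K> nw ?N nx (?f i)" if "i < nw" for i
    using that Y_data by (intro conic_system_scalar_eq[OF fam] lin) auto
  have t: "conic_system \<K> nw ?N nx ?t"
    using Y_data by (intro conic_system_scalar_eq[OF fam] lin) auto
  have b: "conic_system \<K> nw ?N nx (?b i)" if "i < nz" for i
    using that Y_data by (intro conic_system_scalar_eq[OF fam] lin) auto
  have c: "conic_system \<K> nw ?N nx (?c i)" if "i < nv" for i
    using that Y_data by (intro conic_system_scalar_eq[OF fam] lin) auto
  have all: "conic_system \<K> nw ?N nx (\<lambda>f t e x. (\<forall>i<nw. ?f i f t e x) \<and> (?t f t e x \<and>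
      ((\<forall>i<nz. ?b i f t e x) \<and> ((\<forall>i<nv. ?c i f t e x) \<and> (?dual f t e x \<and> ?kon f t e x)))))"
    by (intro conic_system_all_conj[OF fam] conic_system_conj[OF fam] f t b c kon dual)
  show ?thesis
  proof (rule conic_system_cong[OF all])
    fix f e x :: "real Matrix.vec" and t assume f: "f \<in> carrier_vec nw" and e: "e \<in> carrier_vec ?N" and x: "x \<in> carrier_vec nx"
    have "(\<exists>g\<in>carrier_vec nw. \<exists>h\<in>carrier_vec nz. \<exists>\<tau>. \<exists>u\<in>carrier_vec nu. \<exists>\<xi>\<in>carrier_vec l.
         e = g @\<^sub>v h @\<^sub>v vec_of_list [\<tau>] @\<^sub>v u @\<^sub>v \<xi> \<and> ?sys f t g h \<tau> u \<xi> x)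
      \<longleftrightarrow> ?sys f t (?g e) (?h e) (?\<tau> e) (?u e) (?\<xi> e) x" (is "?L = ?R")
    proof
      assume ?L
      then obtain g h \<tau> u \<xi> where *: "g \<in> carrier_vec nw" "h \<in> carrier_vec nz" "u \<in> carrier_vec nu"
        "\<xi> \<in> carrier_vec l" "e = g @\<^sub>v h @\<^sub>v vec_of_list [\<tau>] @\<^sub>v u @\<^sub>v \<xi>" "?sys f t g h \<tau> u \<xi> x"
        by blast
      show ?R unfolding slices_append[OF *(1-5)] by (rule *(6))
    next
      assume ?R
      then show ?L
        using append_slices[OF e] vec_slice_carrier by blast
    qed
    also have "f = ?g e - transpose_mat A *\<^sub>v ?\<xi> e \<longleftrightarrow> (\<forall>i<nw. ?f i f t e x)"
      using f Y_data by (auto simp: vec_eq_iff vec_slice_def simp del: index_mult_mat_vec)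
    also have "t = r \<bullet> ?\<xi> e + ?\<tau> e \<longleftrightarrow> ?t f t e x"
      using f by auto
    also have "transpose_mat B *\<^sub>v ?\<xi> e = ?h e \<longleftrightarrow> (\<forall>i<nz. ?b i f t e x)"
      using f Y_data by (auto simp: vec_eq_iff vec_slice_def simp del: index_mult_mat_vec)
    also have "transpose_mat C *\<^sub>v ?\<xi> e = 0\<^sub>v nv \<longleftrightarrow> (\<forall>i<nv. ?c i f t e x)"
      using f Y_data by (auto simp: vec_eq_iff simp del: index_mult_mat_vec)
    also have "conic_le (dual_cone l L) (0\<^sub>v l) (?\<xi> e) \<longleftrightarrow> ?dual f t e x"
    proof -
      have "?\<xi> e - 0\<^sub>v l = 0\<^sub>v l - (0\<^sub>m l nw *\<^sub>v f + t \<cdot>\<^sub>v 0\<^sub>v l + (- ?\<xi> e) + 0\<^sub>m l nx *\<^sub>v x)"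
        using f x by (intro eq_vecI) auto
      then show ?thesis by (simp only: conic_le_def)
    qed
    also have "G *\<^sub>v ?g e + H *\<^sub>v ?h e + ?\<tau> e \<cdot>\<^sub>v p + Q *\<^sub>v ?u e + R *\<^sub>v x =
        0\<^sub>m k nw *\<^sub>v f + t \<cdot>\<^sub>v 0\<^sub>v k + (G *\<^sub>v ?g e + H *\<^sub>v ?h e + ?\<tau> e \<cdot>\<^sub>v p + Q *\<^sub>v ?u e) + R *\<^sub>v x"
      using psi_data f x by (intro eq_vecI) auto
    finally show "(\<exists>g\<in>carrier_vec nw. \<exists>h\<in>carrier_vec nz. \<exists>\<tau>. \<exists>u\<in>carrier_vec nu. \<exists>\<xi>\<in>carrier_vec l.
         e = g @\<^sub>v h @\<^sub>v vec_of_list [\<tau>] @\<^sub>v u @\<^sub>v \<xi> \<and> ?sys f t g h \<tau> u \<xi> x)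
      \<longleftrightarrow> (\<forall>i<nw. ?f i f t e x) \<and> (?t f t e x \<and>
        ((\<forall>i<nz. ?b i f t e x) \<and> ((\<forall>i<nv. ?c i f t e x) \<and> (?dual f t e x \<and> ?kon f t e x))))" .
  qed
qed

subsection \<open>Representability of the partial maximum\<close>

lemma vec_comb_append:
  assumes "w \<in> carrier_vec n" "w' \<in> carrier_vec n" "z \<in> carrier_vec m" "z' \<in> carrier_vec m"
  shows "a \<cdot>\<^sub>v (w @\<^sub>v z) + b \<cdot>\<^sub>v (w' @\<^sub>v z') =
    (a \<cdot>\<^sub>v w + b \<cdot>\<^sub>v w') @\<^sub>v (a \<cdot>\<^sub>v z + b \<cdot>\<^sub>v z' :: real Matrix.vec)"
  using assms by (intro eq_vecI) auto

lemma vec_convex_proj_fst: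
  assumes Y: "vec_convex Y"
  shows "vec_convex (proj_fst nw nz Y)"
  unfolding vec_convex_def
proof (intro ballI allI impI)
  fix w w' :: "real Matrix.vec" and a b :: real
  assume "w \<in> proj_fst nw nz Y" "w' \<in> proj_fst nw nz Y" and ab: "0 \<le> a" "0 \<le> b" "a + b = 1"
  then obtain z z' where 1: "w \<in> carrier_vec nw" "z \<in> carrier_vec nz" "w @\<^sub>v z \<in> Y"
    and 2: "w' \<in> carrier_vec nw" "z' \<in> carrier_vec nz" "w' @\<^sub>v z' \<in> Y"
    by (auto simp: proj_fst_def)
  have "(a \<cdot>\<^sub>v w + b \<cdot>\<^sub>v w') @\<^sub>v (a \<cdot>\<^sub>v z + b \<cdot>\<^sub>v z') \<in> Y"
    using Y 1(3) 2(3) ab unfolding vec_comb_append[OF 1(1) 2(1) 1(2) 2(2), symmetric]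
    by (auto simp: vec_convex_def)
  then show "a \<cdot>\<^sub>v w + b \<cdot>\<^sub>v w' \<in> proj_fst nw nz Y"
    using 1 2 by (auto simp: proj_fst_def intro!: bexI[of _ "a \<cdot>\<^sub>v z + b \<cdot>\<^sub>v z'"])
qed

lemma vec_convex_slice:
  assumes Y: "vec_convex Y" and w: "w \<in> carrier_vec n"
  shows "vec_convex {z \<in> carrier_vec m. w @\<^sub>v z \<in> Y}"
  unfolding vec_convex_def
proof (intro ballI allI impI)
  fix z z' :: "real Matrix.vec" and a b :: real
  assume z: "z \<in> {z \<in> carrier_vec m. w @\<^sub>v z \<in> Y}" "z' \<in> {z \<in> carrier_vec m. w @\<^sub>v z \<in> Y}"
    and ab: "0 \<le> a" "0 \<le> b" "a + b = 1"
  have "a \<cdot>\<^sub>v w + b \<cdot>\<^sub>v w = w"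
    using w ab(3) by (simp add: add_smult_distrib_vec[symmetric])
  moreover have "a \<cdot>\<^sub>v (w @\<^sub>v z) + b \<cdot>\<^sub>v (w @\<^sub>v z') \<in> Y"
    using Y z ab by (auto simp: vec_convex_def)
  ultimately show "a \<cdot>\<^sub>v z + b \<cdot>\<^sub>v z' \<in> {z \<in> carrier_vec m. w @\<^sub>v z \<in> Y}"
    using vec_comb_append[OF w w, of z m z' a b] z by auto
qed

text \<open>The slice is compact and \<open>\<psi>\<close> is continuous on it, so the real supremum
  in \<open>partial_max\<close> is a genuine maximum.\<close>

lemma partial_max_attained:
  assumes psi: "continuous_map
      (prod_topology (subtopology (vec_topology nx) X) (subtopology (vec_topology (nw + nz)) Y))
      euclideanreal (\<lambda>(x, y). \<psi> x y)"
    and Y: "compactin (vec_topology (nw + nz)) Y"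
    and x: "x \<in> X" "x \<in> carrier_vec nx" and w: "w \<in> proj_fst nw nz Y"
  obtains z where "z \<in> carrier_vec nz" "w @\<^sub>v z \<in> Y" "partial_max nz Y \<psi> x w = \<psi> x (w @\<^sub>v z)"
    "\<And>z'. \<lbrakk>z' \<in> carrier_vec nz; w @\<^sub>v z' \<in> Y\<rbrakk> \<Longrightarrow> \<psi> x (w @\<^sub>v z') \<le> \<psi> x (w @\<^sub>v z)"
proof -
  let ?Z = "{z \<in> carrier_vec nz. w @\<^sub>v z \<in> Y}"
  let ?T = "subtopology (vec_topology nz) ?Z"
  have wc: "w \<in> carrier_vec nw" and ne: "?Z \<noteq> {}" using w by (auto simp: proj_fst_def)
  have "continuous_map ?T (vec_topology (nw + nz)) (\<lambda>z. w @\<^sub>v z)"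
  proof (rule continuous_map_into_vec_topology)
    fix i assume i: "i < nw + nz"
    show "continuous_map ?T euclideanreal (\<lambda>z. (w @\<^sub>v z) $ i)"
    proof (cases "i < nw")
      case True
      then have "continuous_map ?T euclideanreal (\<lambda>z. w $ i)" by simp
      then show ?thesis by (rule continuous_map_eq) (use wc True in auto)
    next
      case False
      then have "continuous_map ?T euclideanreal (\<lambda>z. z $ (i - nw))"
        using i by (intro continuous_map_from_subtopology continuous_map_vec_index) auto
      then show ?thesis by (rule continuous_map_eq) (use wc i False in auto)
    qed
  qed (use wc in auto)
  then have "continuous_map ?T
      (prod_topology (subtopology (vec_topology nx) X) (subtopology (vec_topology (nw + nz)) Y))
      (\<lambda>z. (x, w @\<^sub>v z))"
    using x by (intro continuous_map_pairedI) (auto simp: continuous_map_in_subtopology)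
  from continuous_map_compose[OF this psi]
  have "continuous_map ?T euclideanreal (\<lambda>z. \<psi> x (w @\<^sub>v z))" by (simp add: comp_def)
  then obtain z where z: "z \<in> ?Z" "\<And>z'. z' \<in> ?Z \<Longrightarrow> \<psi> x (w @\<^sub>v z') \<le> \<psi> x (w @\<^sub>v z)"
    using compactin_attains_sup[OF compactin_vec_slice[OF Y wc] ne] by blast
  have "partial_max nz Y \<psi> x w = \<psi> x (w @\<^sub>v z)"
    unfolding partial_max_def using z by (intro cSup_eq_maximum) auto
  with z show thesis by (intro that[of z]) auto
qed

text \<open>Attainment is part of the conclusion because \<open>partial_max\<close> is defined by a
  real supremum. The identity stands outside the implication from continuity, and the last conjunct
  names the explicit system, with the tuple stacked into one vector.\<close>

theorem mainTheorem9:
  fixes \<K> :: "nat \<Rightarrow> real Matrix.vec set set"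
    and X Y K L :: "real Matrix.vec set"
    and \<psi> :: "real Matrix.vec \<Rightarrow> real Matrix.vec \<Rightarrow> real"
    and nx nw nz nu nv k l :: nat
    and G H Q R A B C :: "real mat"
    and p s r :: "real Matrix.vec"
  assumes family: "cone_family \<K>"
    and X: "conic_domain \<K> nx X"
    and Y: "conic_domain \<K> (nw + nz) Y"
    and psi: "continuous_convex_concave nx X (nw + nz) Y \<psi>"
    and K: "K \<in> \<K> k"
    and psi_data: "G \<in> carrier_mat k nw" "H \<in> carrier_mat k nz" "p \<in> carrier_vec k"
      "Q \<in> carrier_mat k nu" "R \<in> carrier_mat k nx" "s \<in> carrier_vec k"
    and psi_rep: "\<forall>x\<in>X. \<forall>w\<in>carrier_vec nw. \<forall>z\<in>carrier_vec nz. w @\<^sub>v z \<in> Y \<longrightarrow>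
      ereal (\<psi> x (w @\<^sub>v z)) =
        Inf {ereal (g \<bullet> w + h \<bullet> z + \<tau>) | g h \<tau> u.
               g \<in> carrier_vec nw \<and> h \<in> carrier_vec nz \<and> u \<in> carrier_vec nu \<and>
               conic_le K (G *\<^sub>v g + H *\<^sub>v h + \<tau> \<cdot>\<^sub>v p + Q *\<^sub>v u + R *\<^sub>v x) s}"
    and Y_compact: "compactin (vec_topology (nw + nz)) Y"
    and L: "L \<in> \<K> l"
    and Y_data: "A \<in> carrier_mat l nw" "B \<in> carrier_mat l nz" "C \<in> carrier_mat l nv"
      "r \<in> carrier_vec l"
    and Y_rep: "Y = {w @\<^sub>v z | w z. w \<in> carrier_vec nw \<and> z \<in> carrier_vec nz \<and>
      (\<exists>v\<in>carrier_vec nv. conic_le L (A *\<^sub>v w + B *\<^sub>v z + C *\<^sub>v v) r)}"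
    and feasible: "\<forall>w\<in>proj_fst nw nz Y.
      ess_strictly_feasible l L (nz + nv) (append_cols B C) (r - A *\<^sub>v w)"
  shows
    "let W = proj_fst nw nz Y;
         \<psi>' = partial_max nz Y \<psi>;
         S = (\<lambda>f t g h \<tau> u \<xi> x.
                f = g - transpose_mat A *\<^sub>v \<xi> \<and> t = r \<bullet> \<xi> + \<tau> \<and>
                transpose_mat B *\<^sub>v \<xi> = h \<and> transpose_mat C *\<^sub>v \<xi> = 0\<^sub>v nv \<and>
                conic_le (dual_cone l L) (0\<^sub>v l) \<xi> \<and>
                conic_le K (G *\<^sub>v g + H *\<^sub>v h + \<tau> \<cdot>\<^sub>v p + Q *\<^sub>v u + R *\<^sub>v x) s)
     in
       \<comment> \<open>the maximum in the definition of \<open>\<psi>'\<close> is attained\<close>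
       (\<forall>x\<in>X. \<forall>w\<in>W.
          (\<exists>z\<in>carrier_vec nz. w @\<^sub>v z \<in> Y \<and> \<psi>' x w = \<psi> x (w @\<^sub>v z)) \<and>
          (\<forall>z\<in>carrier_vec nz. w @\<^sub>v z \<in> Y \<longrightarrow> \<psi> x (w @\<^sub>v z) \<le> \<psi>' x w)) \<and>
       (\<forall>x\<in>X. \<forall>w\<in>W. ereal (\<psi>' x w) =
          Inf {ereal (f \<bullet> w + t) | f t g h \<tau> u \<xi>.
                 f \<in> carrier_vec nw \<and> g \<in> carrier_vec nw \<and> h \<in> carrier_vec nz \<and>
                 u \<in> carrier_vec nu \<and> \<xi> \<in> carrier_vec l \<and> S f t g h \<tau> u \<xi> x}) \<and>
       (continuous_map
          (prod_topology (subtopology (vec_topology nx) X) (subtopology (vec_topology nw) W))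
          euclideanreal (\<lambda>(x, w). \<psi>' x w) \<longrightarrow>
        conic_representable_fun \<K> nx X nw W \<psi>' \<and>
        conic_representation \<K> nx X nw W \<psi>' (nw + (nz + (1 + (nu + l))))
          (\<lambda>f t e x. \<exists>g\<in>carrier_vec nw. \<exists>h\<in>carrier_vec nz. \<exists>\<tau>.
             \<exists>u\<in>carrier_vec nu. \<exists>\<xi>\<in>carrier_vec l.
               e = g @\<^sub>v h @\<^sub>v vec_of_list [\<tau>] @\<^sub>v u @\<^sub>v \<xi> \<and> S f t g h \<tau> u \<xi> x))"
proof -
  let ?W = "proj_fst nw nz Y"
  let ?\<psi> = "partial_max nz Y \<psi>"
  have Xc: "X \<subseteq> carrier_vec nx" and Xconv: "vec_convex X"
    using X unfolding conic_domain_def conic_representable_set_def by auto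
  have Yconv: "vec_convex Y" using Y unfolding conic_domain_def by simp
  have Wc: "?W \<subseteq> carrier_vec nw" by (auto simp: proj_fst_def)
  have psi_cont: "continuous_map
      (prod_topology (subtopology (vec_topology nx) X) (subtopology (vec_topology (nw + nz)) Y))
      euclideanreal (\<lambda>(x, y). \<psi> x y)"
    and convex: "\<And>y. y \<in> Y \<Longrightarrow> vec_convex_on X (\<lambda>x. \<psi> x y)"
    and concave: "\<And>x. x \<in> X \<Longrightarrow> vec_convex_on Y (\<lambda>y. - \<psi> x y)"
    using psi unfolding continuous_convex_concave_def by auto
  have attained: "\<exists>z\<in>carrier_vec nz. w @\<^sub>v z \<in> Y \<and> ?\<psi> x w = \<psi> x (w @\<^sub>v z)"
    and upper: "\<And>z. \<lbrakk>z \<in> carrier_vec nz; w @\<^sub>v z \<in> Y\<rbrakk> \<Longrightarrow> \<psi> x (w @\<^sub>v z) \<le> ?\<psi> x w"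
    if x: "x \<in> X" and w: "w \<in> ?W" for x w
  proof -
    obtain z where "z \<in> carrier_vec nz" "w @\<^sub>v z \<in> Y" "?\<psi> x w = \<psi> x (w @\<^sub>v z)"
      "\<And>z'. \<lbrakk>z' \<in> carrier_vec nz; w @\<^sub>v z' \<in> Y\<rbrakk> \<Longrightarrow> \<psi> x (w @\<^sub>v z') \<le> \<psi> x (w @\<^sub>v z)"
      using partial_max_attained[OF psi_cont Y_compact x _ w] Xc x by blast
    then show "\<exists>z\<in>carrier_vec nz. w @\<^sub>v z \<in> Y \<and> ?\<psi> x w = \<psi> x (w @\<^sub>v z)"
      "\<And>z. \<lbrakk>z \<in> carrier_vec nz; w @\<^sub>v z \<in> Y\<rbrakk> \<Longrightarrow> \<psi> x (w @\<^sub>v z) \<le> ?\<psi> x w"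
      by auto
  qed
  have mem_Y: "w @\<^sub>v z \<in> Y \<longleftrightarrow> (\<exists>v\<in>carrier_vec nv. conic_le L (A *\<^sub>v w + B *\<^sub>v z + C *\<^sub>v v) r)"
    if "w \<in> carrier_vec nw" "z \<in> carrier_vec nz" for w z
  proof
    assume "w @\<^sub>v z \<in> Y"
    then obtain w' z' v where *: "w @\<^sub>v z = w' @\<^sub>v z'" "w' \<in> carrier_vec nw" "v \<in> carrier_vec nv"
      "conic_le L (A *\<^sub>v w' + B *\<^sub>v z' + C *\<^sub>v v) r"
      unfolding Y_rep by blast
    have "w = w' \<and> z = z'" using *(1) append_vec_eq[OF that(1) *(2)] by simp
    with * show "\<exists>v\<in>carrier_vec nv. conic_le L (A *\<^sub>v w + B *\<^sub>v z + C *\<^sub>v v) r" by auto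
  qed (use that in \<open>auto simp: Y_rep\<close>)
  have Kconv: "vec_convex K"
    using family K regular_cone_convex unfolding cone_family_def by blast
  have identity: "ereal (?\<psi> x w) =
    Inf {ereal (f \<bullet> w + t) | f t g h \<tau> u \<xi>.
      f \<in> carrier_vec nw \<and> g \<in> carrier_vec nw \<and> h \<in> carrier_vec nz \<and>
      u \<in> carrier_vec nu \<and> \<xi> \<in> carrier_vec l \<and>
      f = g - transpose_mat A *\<^sub>v \<xi> \<and> t = r \<bullet> \<xi> + \<tau> \<and>
      transpose_mat B *\<^sub>v \<xi> = h \<and> transpose_mat C *\<^sub>v \<xi> = 0\<^sub>v nv \<and>
      conic_le (dual_cone l L) (0\<^sub>v l) \<xi> \<and>
      conic_le K (G *\<^sub>v g + H *\<^sub>v h + \<tau> \<cdot>\<^sub>v p + Q *\<^sub>v u + R *\<^sub>v x) s}"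
    if x: "x \<in> X" and w: "w \<in> ?W" for x w
  proof -
    let ?Z = "{z \<in> carrier_vec nz. w @\<^sub>v z \<in> Y}"
    have xc: "x \<in> carrier_vec nx" and wc: "w \<in> carrier_vec nw" using x w Xc Wc by auto
    obtain z where z: "z \<in> carrier_vec nz" "w @\<^sub>v z \<in> Y" "?\<psi> x w = \<psi> x (w @\<^sub>v z)"
      using attained[OF x w] by blast
    show ?thesis
      unfolding z(3)
    proof (rule max_eq_dual_inf[where Z = ?Z and \<phi> = "\<lambda>z. \<psi> x (w @\<^sub>v z)",
          OF Kconv psi_data Y_data xc wc])
      show "compactin (vec_topology nz) ?Z" by (rule compactin_vec_slice[OF Y_compact wc])
      show "vec_convex ?Z" by (rule vec_convex_slice[OF Yconv wc])
      show "z \<in> ?Z \<longleftrightarrow> (\<exists>v\<in>carrier_vec nv. conic_le L (A *\<^sub>v w + B *\<^sub>v z + C *\<^sub>v v) r)"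
        if "z \<in> carrier_vec nz" for z
        using mem_Y[OF wc that] that by simp
      show "ess_strictly_feasible l L (nz + nv) (append_cols B C) (r - A *\<^sub>v w)"
        using feasible w by blast
      show "ereal (\<psi> x (w @\<^sub>v z)) =
        Inf {ereal (g \<bullet> w + h \<bullet> z + \<tau>) | g h \<tau> u.
          g \<in> carrier_vec nw \<and> h \<in> carrier_vec nz \<and> u \<in> carrier_vec nu \<and>
          conic_le K (G *\<^sub>v g + H *\<^sub>v h + \<tau> \<cdot>\<^sub>v p + Q *\<^sub>v u + R *\<^sub>v x) s}" if "z \<in> ?Z" for z
        using psi_rep x wc that by blast
      show "z \<in> ?Z" using z by simp
      show "\<psi> x (w @\<^sub>v z') \<le> \<psi> x (w @\<^sub>v z)" if "z' \<in> ?Z" for z'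
        using upper[OF x w] that z(3) by simp
    qed
  qed
  have W_dom: "conic_domain \<K> nw ?W"
    unfolding conic_domain_def
  proof (intro conjI)
    obtain y where "y \<in> Y" using Y unfolding conic_domain_def by blast
    then show "?W \<noteq> {}" unfolding Y_rep proj_fst_def by blast
    show "vec_convex ?W" by (rule vec_convex_proj_fst[OF Yconv])
    \<comment> \<open>A projection is representable by the same constraint, with \<open>z\<close>
      joining \<open>v\<close> among the auxiliary variables.\<close>
    have "?W = {w \<in> carrier_vec nw. \<exists>y\<in>carrier_vec (nz + nv).
        conic_le L (A *\<^sub>v w + append_cols B C *\<^sub>v y) r}" (is "_ = ?W'")
    proof (intro subset_antisym subsetI)
      fix w assume "w \<in> ?W"
      then obtain z v where *: "w \<in> carrier_vec nw" "z \<in> carrier_vec nz" "v \<in> carrier_vec nv"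
        "conic_le L (A *\<^sub>v w + B *\<^sub>v z + C *\<^sub>v v) r"
        using mem_Y by (auto simp: proj_fst_def)
      have "A *\<^sub>v w + append_cols B C *\<^sub>v (z @\<^sub>v v) = A *\<^sub>v w + B *\<^sub>v z + C *\<^sub>v v"
        unfolding append_cols_mult[OF Y_data(2,3) *(2,3)]
        using Y_data * by (intro eq_vecI) (auto simp del: index_mult_mat_vec)
      then show "w \<in> ?W'" using * by (auto intro!: bexI[of _ "z @\<^sub>v v"])
    next
      fix w assume "w \<in> ?W'"
      then obtain y where *: "w \<in> carrier_vec nw" "y \<in> carrier_vec (nz + nv)"
        "conic_le L (A *\<^sub>v w + append_cols B C *\<^sub>v y) r" by blast
      obtain z v where zv: "y = z @\<^sub>v v" "z \<in> carrier_vec nz" "v \<in> carrier_vec nv"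
        using vec_first_last_append[OF *(2)] vec_first_carrier vec_last_carrier by metis
      have "A *\<^sub>v w + append_cols B C *\<^sub>v y = A *\<^sub>v w + B *\<^sub>v z + C *\<^sub>v v"
        unfolding zv(1) append_cols_mult[OF Y_data(2,3) zv(2,3)]
        using Y_data * zv by (intro eq_vecI) (auto simp del: index_mult_mat_vec)
      then show "w \<in> ?W" using * zv mem_Y[OF *(1) zv(2)] by (auto simp: proj_fst_def)
    qed
    then show "conic_representable_set \<K> nw ?W"
      unfolding conic_representable_set_def
      using L Y_data append_cols_carrier[OF Y_data(2,3)] by blast
  qed
  have convex': "vec_convex_on X (\<lambda>x. ?\<psi> x w)" if w: "w \<in> ?W" for w
    unfolding vec_convex_on_def
  proof (intro ballI allI impI)
    fix x y :: "real Matrix.vec" and a b :: real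
    assume x: "x \<in> X" and y: "y \<in> X" and ab: "0 \<le> a" "0 \<le> b" "a + b = 1"
    have "a \<cdot>\<^sub>v x + b \<cdot>\<^sub>v y \<in> X" using Xconv x y ab by (auto simp: vec_convex_def)
    \<comment> \<open>A maximiser for the combined point is an admissible competitor at
      \<open>x\<close> and at \<open>y\<close>.\<close>
    then obtain z where z: "z \<in> carrier_vec nz" "w @\<^sub>v z \<in> Y"
      "?\<psi> (a \<cdot>\<^sub>v x + b \<cdot>\<^sub>v y) w = \<psi> (a \<cdot>\<^sub>v x + b \<cdot>\<^sub>v y) (w @\<^sub>v z)"
      using attained w by blast
    note z(3)
    also have "\<psi> (a \<cdot>\<^sub>v x + b \<cdot>\<^sub>v y) (w @\<^sub>v z) \<le> a * \<psi> x (w @\<^sub>v z) + b * \<psi> y (w @\<^sub>v z)"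
      using convex[OF z(2)] x y ab by (auto simp: vec_convex_on_def)
    also have "\<dots> \<le> a * ?\<psi> x w + b * ?\<psi> y w"
      using upper[OF x w z(1,2)] upper[OF y w z(1,2)] ab by (intro add_mono mult_left_mono) auto
    finally show "?\<psi> (a \<cdot>\<^sub>v x + b \<cdot>\<^sub>v y) w \<le> a * ?\<psi> x w + b * ?\<psi> y w" .
  qed
  have concave': "vec_convex_on ?W (\<lambda>w. - ?\<psi> x w)" if x: "x \<in> X" for x
    unfolding vec_convex_on_def
  proof (intro ballI allI impI)
    fix w w' :: "real Matrix.vec" and a b :: real
    assume w: "w \<in> ?W" and w': "w' \<in> ?W" and ab: "0 \<le> a" "0 \<le> b" "a + b = 1"
    obtain z where z: "z \<in> carrier_vec nz" "w @\<^sub>v z \<in> Y" "?\<psi> x w = \<psi> x (w @\<^sub>v z)"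
      using attained[OF x w] by blast
    obtain z' where z': "z' \<in> carrier_vec nz" "w' @\<^sub>v z' \<in> Y" "?\<psi> x w' = \<psi> x (w' @\<^sub>v z')"
      using attained[OF x w'] by blast
    \<comment> \<open>Concavity of \<open>\<psi>\<close> jointly in \<open>[w;z]\<close>: the
      combined maximisers form an admissible competitor over the combined \<open>w\<close>.\<close>
    let ?w = "a \<cdot>\<^sub>v w + b \<cdot>\<^sub>v w'" and ?z = "a \<cdot>\<^sub>v z + b \<cdot>\<^sub>v z'"
    have comb: "a \<cdot>\<^sub>v (w @\<^sub>v z) + b \<cdot>\<^sub>v (w' @\<^sub>v z') = ?w @\<^sub>v ?z"
      using w w' z z' Wc by (intro vec_comb_append) auto
    have "?w @\<^sub>v ?z \<in> Y"
      unfolding comb[symmetric] using Yconv z z' ab by (auto simp: vec_convex_def)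
    moreover have "?w \<in> ?W"
      using vec_convex_proj_fst[OF Yconv, of nw nz] w w' ab by (auto simp: vec_convex_def)
    ultimately have "- ?\<psi> x ?w \<le> - \<psi> x (?w @\<^sub>v ?z)" using upper[OF x] z z' by simp
    also have "\<dots> \<le> a * - \<psi> x (w @\<^sub>v z) + b * - \<psi> x (w' @\<^sub>v z')"
      using concave[OF x] z z' ab unfolding comb[symmetric] vec_convex_on_def by blast
    finally show "- ?\<psi> x ?w \<le> a * - ?\<psi> x w + b * - ?\<psi> x w'" using z z' by simp
  qed
  let ?S = "\<lambda>f t g h \<tau> u \<xi> x. f = g - transpose_mat A *\<^sub>v \<xi> \<and> t = r \<bullet> \<xi> + \<tau> \<and>
      transpose_mat B *\<^sub>v \<xi> = h \<and> transpose_mat C *\<^sub>v \<xi> = 0\<^sub>v nv \<and>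
      conic_le (dual_cone l L) (0\<^sub>v l) \<xi> \<and>
      conic_le K (G *\<^sub>v g + H *\<^sub>v h + \<tau> \<cdot>\<^sub>v p + Q *\<^sub>v u + R *\<^sub>v x) s"
  let ?\<Phi> = "\<lambda>f t e x. \<exists>g\<in>carrier_vec nw. \<exists>h\<in>carrier_vec nz. \<exists>\<tau>.
      \<exists>u\<in>carrier_vec nu. \<exists>\<xi>\<in>carrier_vec l.
        e = g @\<^sub>v h @\<^sub>v vec_of_list [\<tau>] @\<^sub>v u @\<^sub>v \<xi> \<and> ?S f t g h \<tau> u \<xi> x"
  let ?N = "nw + (nz + (1 + (nu + l)))"
  have rep: "conic_representation \<K> nx X nw ?W ?\<psi> ?N ?\<Phi>"
    unfolding conic_representation_def
  proof (intro conjI ballI)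
    show "conic_system \<K> nw ?N nx ?\<Phi>"
      by (rule conic_system_partial_max[OF family K L psi_data Y_data])
    fix x w assume x: "x \<in> X" and w: "w \<in> ?W"
    have "{ereal (f \<bullet> w + t) | f t g h \<tau> u \<xi>.
        f \<in> carrier_vec nw \<and> g \<in> carrier_vec nw \<and> h \<in> carrier_vec nz \<and>
        u \<in> carrier_vec nu \<and> \<xi> \<in> carrier_vec l \<and> ?S f t g h \<tau> u \<xi> x}
      = {ereal (f \<bullet> w + t) | f t e. f \<in> carrier_vec nw \<and> e \<in> carrier_vec ?N \<and> ?\<Phi> f t e x}"
      (is "?D = ?D'")
    proof (intro subset_antisym subsetI)
      fix d assume "d \<in> ?D"
      then obtain f t g h \<tau> u \<xi> where *: "d = ereal (f \<bullet> w + t)" "f \<in> carrier_vec nw"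
        "g \<in> carrier_vec nw" "h \<in> carrier_vec nz" "u \<in> carrier_vec nu" "\<xi> \<in> carrier_vec l"
        "?S f t g h \<tau> u \<xi> x" by blast
      have "g @\<^sub>v h @\<^sub>v vec_of_list [\<tau>] @\<^sub>v u @\<^sub>v \<xi> \<in> carrier_vec ?N"
        using *(3-6) by (intro append_carrier_vec) auto
      with * show "d \<in> ?D'" by blast
    next
      fix d assume "d \<in> ?D'"
      then show "d \<in> ?D" by blast
    qed
    with identity[OF x w] show "ereal (?\<psi> x w) =
      Inf {ereal (f \<bullet> w + t) | f t e. f \<in> carrier_vec nw \<and> e \<in> carrier_vec ?N \<and> ?\<Phi> f t e x}"
      by simp
  qed
  show ?thesis
    unfolding Let_def
  proof (intro conjI impI ballI)
    show "\<exists>z\<in>carrier_vec nz. w @\<^sub>v z \<in> Y \<and> ?\<psi> x w = \<psi> x (w @\<^sub>v z)"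
      if "x \<in> X" "w \<in> ?W" for x w by (rule attained[OF that])
    show "w @\<^sub>v z \<in> Y \<Longrightarrow> \<psi> x (w @\<^sub>v z) \<le> ?\<psi> x w"
      if "x \<in> X" "w \<in> ?W" "z \<in> carrier_vec nz" for x w z by (rule upper[OF that])
  next
    assume "continuous_map
      (prod_topology (subtopology (vec_topology nx) X) (subtopology (vec_topology nw) ?W))
      euclideanreal (\<lambda>(x, w). ?\<psi> x w)"
    then have "continuous_convex_concave nx X nw ?W ?\<psi>"
      using convex' concave' unfolding continuous_convex_concave_def by blast
    with X W_dom rep show "conic_representable_fun \<K> nx X nw ?W ?\<psi>"
      unfolding conic_representable_fun_def by blast
  qed (use identity rep in blast)+
qed

end
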